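(* Let $G$ be a finite group and let $\rho:G\to\mathrm{GL}(V)$ be a finite-dimensional complex representation. Any connected component of the McKay quiver $\Gamma_\rho(G)$ containing a vertex corresponding to a one-dimensional representation of $G$ is isomorphic (as a quiver) to the principal component of $\Gamma_\rho(G)$. In particular, if $G$ is abelian then all the connected components of $\Gamma_\rho(G)$ are isomorphic.
   Context: Let $\sigma_1,\dots,\sigma_r$ be a complete list of the irreducible complex representations of $G$ up to isomorphism, with $\sigma_1$ trivial. The McKay matrix $A_\rho(G)=(a_{ij})_{i,j=1}^r$ has as entries the non-negative integers determined by $\rho\otimes\sigma_i\cong\bigoplus_{j=1}^r\sigma_j^{\oplus a_{ij}}$. The McKay quiver $\Gamma_\rho(G)$ is the quiver with vertices $v_1,\dots,v_r$ and $a_{ij}$ directed edges from $v_i$ to $v_j$; the vertex $v_i$ corresponds to $\sigma_i$. A connected component of $\Gamma_\rho(G)$ means a strongly connected component (maximal subquiver in which there is a directed path, possibly of length $0$, from any vertex to any other) or equivalently a weakly connected component (connected component after forgetting edge directions); for McKay quivers these two notions coincide. The principal component is the connected component containing $v_1$. *)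

theory Defs
  imports "Jordan_Normal_Form.VS_Connect" "Graph_Theory.Graph_Theory"
begin

text \<open>
  Finite-dimensional complex representations are given in coordinates: the space is
  \<open>\<complex>\<^sup>n\<close> (\<open>carrier_vec n\<close>, with \<open>n = 0\<close> allowed) and group elements act by
  invertible \<open>n \<times> n\<close> matrices.  Values of \<open>rep_mat\<close> outside the carrier of the group
  are irrelevant.
\<close>

record 'g rep =
  rep_dim :: nat
  rep_mat :: "'g \<Rightarrow> complex mat"

definition GL :: "nat \<Rightarrow> complex mat monoid" where
  "GL n = units_of (ring_mat TYPE(complex) n ())"

definition group_rep :: "('g, 'b) monoid_scheme \<Rightarrow> 'g rep \<Rightarrow> bool" where
  "group_rep G \<rho> \<longleftrightarrow> rep_mat \<rho> \<in> hom G (GL (rep_dim \<rho>))"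

definition trivial_rep :: "'g rep" where
  "trivial_rep = \<lparr>rep_dim = 1, rep_mat = (\<lambda>g. 1\<^sub>m 1)\<rparr>"

definition rep_iso :: "('g, 'b) monoid_scheme \<Rightarrow> 'g rep \<Rightarrow> 'g rep \<Rightarrow> bool" where
  "rep_iso G \<rho> \<tau> \<longleftrightarrow>
     (\<exists>P \<in> carrier_mat (rep_dim \<tau>) (rep_dim \<rho>). invertible_mat P \<and>
        (\<forall>g \<in> carrier G. P * rep_mat \<rho> g = rep_mat \<tau> g * P))"

definition irreducible_rep :: "('g, 'b) monoid_scheme \<Rightarrow> 'g rep \<Rightarrow> bool" where
  "irreducible_rep G \<rho> \<longleftrightarrow>
     group_rep G \<rho> \<and> rep_dim \<rho> > 0 \<and>
     (\<forall>W. VectorSpace.subspace class_ring W (module_vec TYPE(complex) (rep_dim \<rho>)) \<and>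
          (\<forall>g \<in> carrier G. \<forall>w \<in> W. rep_mat \<rho> g *\<^sub>v w \<in> W) \<longrightarrow>
          W = {0\<^sub>v (rep_dim \<rho>)} \<or> W = carrier_vec (rep_dim \<rho>))"

definition kronecker :: "complex mat \<Rightarrow> complex mat \<Rightarrow> complex mat" where
  "kronecker A B = mat (dim_row A * dim_row B) (dim_col A * dim_col B)
     (\<lambda>(i, j). A $$ (i div dim_row B, j div dim_col B) * B $$ (i mod dim_row B, j mod dim_col B))"

text \<open>
  The tensor product in the basis \<open>e\<^sub>i \<otimes> f\<^sub>j\<close>, ordered lexicographically.
\<close>

definition tensor_rep :: "'g rep \<Rightarrow> 'g rep \<Rightarrow> 'g rep" where
  "tensor_rep \<rho> \<tau> = \<lparr>rep_dim = rep_dim \<rho> * rep_dim \<tau>,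
                    rep_mat = (\<lambda>g. kronecker (rep_mat \<rho> g) (rep_mat \<tau> g))\<rparr>"

definition direct_sum_rep :: "'g rep list \<Rightarrow> 'g rep" where
  "direct_sum_rep \<tau>s = \<lparr>rep_dim = (\<Sum>\<tau>\<leftarrow>\<tau>s. rep_dim \<tau>),
                       rep_mat = (\<lambda>g. diag_block_mat (map (\<lambda>\<tau>. rep_mat \<tau> g) \<tau>s))\<rparr>"

definition complete_irreps ::
  "('g, 'b) monoid_scheme \<Rightarrow> nat \<Rightarrow> (nat \<Rightarrow> 'g rep) \<Rightarrow> bool" where
  "complete_irreps G r \<sigma> \<longleftrightarrow>
     (\<forall>i \<in> {1..r}. irreducible_rep G (\<sigma> i)) \<and>
     (\<forall>i \<in> {1..r}. \<forall>j \<in> {1..r}. rep_iso G (\<sigma> i) (\<sigma> j) \<longrightarrow> i = j) \<and>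
     (\<forall>\<tau>. irreducible_rep G \<tau> \<longrightarrow> (\<exists>i \<in> {1..r}. rep_iso G \<tau> (\<sigma> i))) \<and>
     1 \<le> r \<and> rep_iso G (\<sigma> 1) trivial_rep"

definition mckay_matrix ::
  "('g, 'b) monoid_scheme \<Rightarrow> 'g rep \<Rightarrow> nat \<Rightarrow> (nat \<Rightarrow> 'g rep) \<Rightarrow> (nat \<Rightarrow> nat \<Rightarrow> nat) \<Rightarrow> bool" where
  "mckay_matrix G \<rho> r \<sigma> a \<longleftrightarrow>
     (\<forall>i \<in> {1..r}. rep_iso G (tensor_rep \<rho> (\<sigma> i))
        (direct_sum_rep (concat (map (\<lambda>j. replicate (a i j) (\<sigma> j)) [1..<Suc r]))))"

text \<open>The arc \<open>(i, j, k)\<close> is the \<open>k\<close>-th of the \<open>a i j\<close> arcs from \<open>i\<close> to \<open>j\<close>.\<close>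

definition mckay_quiver ::
  "nat \<Rightarrow> (nat \<Rightarrow> nat \<Rightarrow> nat) \<Rightarrow> (nat, nat \<times> nat \<times> nat) pre_digraph" where
  "mckay_quiver r a =
     \<lparr>verts = {1..r},
      arcs = {(i, j, k). i \<in> {1..r} \<and> j \<in> {1..r} \<and> k < a i j},
      tail = (\<lambda>(i, j, k). i),
      head = (\<lambda>(i, j, k). j)\<rparr>"

definition strong_components :: "('a, 'b) pre_digraph \<Rightarrow> ('a, 'b) pre_digraph set" where
  "strong_components Q = pre_digraph.sccs Q"

definition weak_components :: "('a, 'b) pre_digraph \<Rightarrow> ('a, 'b) pre_digraph set" where
  "weak_components Q = {C. pre_digraph.max_subgraph Q Digraph_Component.connected C}"

end

theory Submission
  imports Defs "Jordan_Normal_Form.Matrix_Kernel" "Jordan_Normal_Form.Spectral_Radius"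
begin

text \<open>
  If \<open>\<sigma>\<^sub>i\<close> and \<open>\<sigma>\<^sub>j\<close> are one-dimensional, twisting by the linear character
  \<open>\<chi> = \<sigma>\<^sub>j / \<sigma>\<^sub>i\<close> permutes the irreducible representations, say \<open>\<chi> \<sigma>\<^sub>k \<cong> \<sigma>\<^bsub>\<pi> k\<^esub>\<close>, and
  \<open>\<pi> i = j\<close>.  Twisting commutes with \<open>\<rho> \<otimes> _\<close> and with direct sums, so uniqueness of
  multiplicities makes \<open>\<pi>\<close> an automorphism of the McKay quiver.  Automorphisms map components
  to components, hence the component of \<open>i\<close> onto that of \<open>j\<close>.  For abelian \<open>G\<close> every
  irreducible representation is one-dimensional by Schur's lemma.

  Multiplicities are unique without complete reducibility: by Schur's lemma an isomorphism
  between two direct sums of irreducibles conjugates the projection onto the \<open>\<phi>\<close>-isotypic part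
  of one into that of the other, and the trace of such a projection is \<open>dim \<phi>\<close> times the
  multiplicity of \<open>\<phi>\<close>.
\<close>

section \<open>Components and automorphisms of digraphs\<close>

text \<open>The union of \<open>C\<close> and \<open>D\<close> is again a subgraph of
  \<open>G\<close> and contains both, so maximality forces each of them to equal it. With
  connectedness as \<open>P\<close>, components that share a vertex coincide.\<close>

lemma max_subgraph_unique:
  assumes C: "pre_digraph.max_subgraph G P C" and D: "pre_digraph.max_subgraph G P D"
    and un: "P (union C D)"
  shows "C = D"
proof -
  have sub: "subgraph C G" "subgraph D G"
    using C D by (auto simp: pre_digraph.max_subgraph_def)
  then have wf: "wf_digraph C" "wf_digraph D" and comp: "compatible C D" "compatible G C"
    by (auto simp: subgraph_def compatible_def)
  have "subgraph (union C D) G"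
    using sub comp by (intro subgraph_union) (auto simp: compatible_def)
  moreover have "subgraph C (union C D)" "subgraph D (union C D)"
    using wf comp by (auto intro: subgraphs_of_union)
  ultimately have "C = union C D" "D = union C D"
    using C D un unfolding pre_digraph.max_subgraph_def by metis+
  then show ?thesis by simp
qed

text \<open>Weak connectedness is strong connectedness of the symmetrised digraph. Symmetrising
  commutes with \<open>union\<close>, which reduces the claim to
  \<open>strongly_connected_non_disj\<close>.\<close>

lemma connected_non_disj:
  assumes "wf_digraph C" "wf_digraph D" "compatible C D"
    and "connected C" "connected D" "verts C \<inter> verts D \<noteq> {}"
  shows "connected (union C D)"
proof -
  have "with_proj (mk_symmetric (union C D)) = union (with_proj (mk_symmetric C)) (with_proj (mk_symmetric D))"
    using assms(3) by (auto simp: mk_symmetric_def union_def with_proj_def compatible_def)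
  moreover have "strongly_connected (union (with_proj (mk_symmetric C)) (with_proj (mk_symmetric D)))"
    using assms wf_digraph.wellformed_mk_symmetric
    by (intro strongly_connected_non_disj)
      (auto simp: connected_def wf_digraph_wp_iff)
  ultimately show ?thesis by (simp add: connected_def)
qed

text \<open>Connectedness is transported forward along \<open>h\<close>; the converse is the same
  fact for the inverse isomorphism.\<close>

lemma connected_app_iso_iff:
  assumes "pre_digraph.digraph_isomorphism G h"
  shows "connected (app_iso h G) \<longleftrightarrow> connected G"
proof -
  interpret wf_digraph G using assms by (auto simp: pre_digraph.digraph_isomorphism_def)
  interpret H: wf_digraph "app_iso h G" using assms ..
  show ?thesis
    using connectedI_app_iso[OF _ assms] H.connectedI_app_iso[OF _ digraph_isomorphism_invI[OF assms]]
    by (auto simp: assms)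
qed

text \<open>Kept general in \<open>P\<close>, so that strong and weak components are handled by one
  argument.\<close>

lemma max_subgraph_automorphism:
  assumes hom: "pre_digraph.digraph_isomorphism G h" and aut: "app_iso h G = G"
    and inv: "\<And>H. subgraph H G \<Longrightarrow> P (app_iso h H) = P H"
    and C: "pre_digraph.max_subgraph G P C"
  shows "pre_digraph.max_subgraph G P (app_iso h C)"
proof -
  interpret wf_digraph G using hom by (auto simp: pre_digraph.digraph_isomorphism_def)
  have sub: "subgraph C G" using C by (rule subgraphI_max_subgraph)
  then have "subgraph (app_iso h C) (app_iso h G)"
    using hom by (rule subgraph_app_isoI[rotated])
  \<comment> \<open>Maximality of the image inside \<open>app_iso h G\<close>, which is
    \<open>G\<close> itself by \<open>aut\<close>, becomes maximality of \<open>C\<close> for the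
    pulled-back property; \<open>inv\<close> identifies the latter with \<open>P\<close>.\<close>
  from max_subgraph_iso[OF hom this, of P]
  have "max_subgraph P (app_iso h C) \<longleftrightarrow> max_subgraph (P \<circ> app_iso h) C"
    using hom sub aut by simp
  also have "\<dots> \<longleftrightarrow> max_subgraph P C"
    by (rule max_subgraph_cong) (auto simp: inv)
  finally show ?thesis using C by simp
qed

text \<open>The image of \<open>C\<close> is again a component, and it meets \<open>D\<close> in the
  image of \<open>u\<close>; overlapping components are equal, so \<open>h\<close> restricts to an
  isomorphism from \<open>C\<close> to \<open>D\<close>.\<close>

lemma components_iso_by_automorphism:
  fixes Q :: "('a, 'b) pre_digraph"
  assumes hom: "pre_digraph.digraph_isomorphism Q h" and aut: "app_iso h Q = Q"
    and comps: "components = strong_components Q \<or> components = weak_components Q"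
    and CD: "C \<in> components" "D \<in> components"
    and u: "u \<in> verts C" "iso_verts h u \<in> verts D"
  shows "digraph_iso C D"
proof -
  \<comment> \<open>\<open>P\<close> is the notion of connectedness that defines
    \<open>components\<close>, so the rest of the argument need not distinguish the two cases of
    \<open>comps\<close>.\<close>
  define P where "P = (if components = strong_components Q then strongly_connected else
    (Digraph_Component.connected :: ('a, 'b) pre_digraph \<Rightarrow> bool))"
  have comp: "components = {H. pre_digraph.max_subgraph Q P H}"
    using comps by (auto simp: P_def strong_components_def weak_components_def pre_digraph.sccs_altdef2)
  have max: "pre_digraph.max_subgraph Q P C" "pre_digraph.max_subgraph Q P D"
    using CD by (auto simp: comp)
  have homH: "pre_digraph.digraph_isomorphism H h" if "subgraph H Q" for H
    using hom that by (rule pre_digraph.digraph_isomorphism_subgraphI)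
  have inv: "P (app_iso h H) = P H" if "subgraph H Q" for H
    using homH[OF that] by (auto simp: P_def connected_app_iso_iff)
  have max': "pre_digraph.max_subgraph Q P (app_iso h C)"
    using hom aut inv max(1) by (rule max_subgraph_automorphism)
  have P: "P (app_iso h C)" "P D"
    using max' max by (auto simp: pre_digraph.max_subgraph_def)
  have sub: "subgraph (app_iso h C) Q" "subgraph D Q" "subgraph C Q"
    using max max' by (auto simp: pre_digraph.max_subgraph_def)
  then have "wf_digraph (app_iso h C)" "wf_digraph D" "compatible (app_iso h C) D"
    by (auto simp: subgraph_def compatible_def)
  moreover have "verts (app_iso h C) \<inter> verts D \<noteq> {}"
    using u by auto
  ultimately have "P (union (app_iso h C) D)"
    using P strongly_connected_non_disj[of "app_iso h C" D] connected_non_disj[of "app_iso h C" D]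
    unfolding P_def by presburger
  then have "app_iso h C = D"
    by (rule max_subgraph_unique[OF max' max(2)])
  then show ?thesis
    using homH sub by (auto simp: digraph_iso_def)
qed

lemma mckay_quiver_components_iso:
  assumes bij: "bij_betw \<pi> {1..r} {1..r}"
    and a: "\<And>i j. i \<in> {1..r} \<Longrightarrow> j \<in> {1..r} \<Longrightarrow> a (\<pi> i) (\<pi> j) = a i j"
    and comps: "components = strong_components (mckay_quiver r a) \<or>
                components = weak_components (mckay_quiver r a)"
    and CD: "C \<in> components" "D \<in> components"
    and u: "u \<in> verts C" "\<pi> u \<in> verts D"
  shows "digraph_iso C D"
proof -
  let ?Q = "mckay_quiver r a"
  \<comment> \<open>A permutation of vertices lifts to arcs by keeping the index \<open>k\<close> of
    a parallel arc. This hits existing arcs because \<open>\<pi>\<close> preserves the number of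
    arcs between any two vertices.\<close>
  define h :: "(nat, nat \<times> nat \<times> nat, nat, nat \<times> nat \<times> nat) digraph_isomorphism" where
    "h = \<lparr>iso_verts = \<pi>, iso_arcs = (\<lambda>(i, j, k). (\<pi> i, \<pi> j, k)),
          iso_head = head ?Q, iso_tail = tail ?Q\<rparr>"
  have inj: "inj_on \<pi> {1..r}" and im: "\<pi> ` {1..r} = {1..r}"
    using bij by (auto simp: bij_betw_def)
  have \<pi>: "\<pi> i \<in> {1..r}" if "i \<in> {1..r}" for i
    using im that by blast
  have wf: "wf_digraph ?Q"
    by unfold_locales (auto simp: mckay_quiver_def)
  have "inj_on (\<lambda>(i, j, k). (\<pi> i, \<pi> j, k)) (arcs ?Q)"
    by (rule inj_onI) (auto simp: mckay_quiver_def dest: inj_onD[OF inj])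
  then have "pre_digraph.digraph_isomorphism ?Q h"
    unfolding pre_digraph.digraph_isomorphism_def using wf inj
    by (auto simp: h_def mckay_quiver_def)
  moreover have "(\<lambda>(i, j, k). (\<pi> i, \<pi> j, k)) ` arcs ?Q = arcs ?Q"
  proof safe
    fix i j k assume "(i, j, k) \<in> arcs ?Q"
    then show "(\<pi> i, \<pi> j, k) \<in> arcs ?Q"
      using \<pi> a by (simp add: mckay_quiver_def del: atLeastAtMost_iff)
  next
    fix i j k assume ijk: "(i, j, k) \<in> arcs ?Q"
    then have "i \<in> \<pi> ` {1..r}" "j \<in> \<pi> ` {1..r}"
      using im by (auto simp: mckay_quiver_def)
    then obtain i' j' where "i' \<in> {1..r}" "j' \<in> {1..r}" "i = \<pi> i'" "j = \<pi> j'"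
      by blast
    with ijk a show "(i, j, k) \<in> (\<lambda>(i, j, k). (\<pi> i, \<pi> j, k)) ` arcs ?Q"
      by (intro image_eqI[of _ _ "(i', j', k)"])
        (simp_all add: mckay_quiver_def del: atLeastAtMost_iff)
  qed
  then have "app_iso h ?Q = ?Q"
    using im by (intro pre_digraph.equality) (simp_all add: h_def mckay_quiver_def)
  ultimately show ?thesis
    using comps CD u(1) by (rule components_iso_by_automorphism) (use u(2) in \<open>simp add: h_def\<close>)
qed

section \<open>Matrices\<close>

definition mat_trace :: "'a :: comm_monoid_add mat \<Rightarrow> 'a" where
  "mat_trace A = (\<Sum>i<dim_row A. A $$ (i, i))"

lemma mat_trace_mult_commute:
  fixes A B :: "'a :: comm_semiring_0 mat"
  assumes "A \<in> carrier_mat n m" "B \<in> carrier_mat m n"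
  shows "mat_trace (A * B) = mat_trace (B * A)"
proof -
  have "mat_trace (A * B) = (\<Sum>i<n. \<Sum>j<m. A $$ (i, j) * B $$ (j, i))"
    using assms by (auto simp: mat_trace_def scalar_prod_def lessThan_atLeast0 intro!: sum.cong)
  also have "\<dots> = (\<Sum>j<m. \<Sum>i<n. A $$ (i, j) * B $$ (j, i))"
    by (rule sum.swap)
  also have "\<dots> = mat_trace (B * A)"
    using assms by (auto simp: mat_trace_def scalar_prod_def lessThan_atLeast0 mult.commute intro!: sum.cong)
  finally show ?thesis .
qed

lemma mat_trace_one: "mat_trace (1\<^sub>m n :: 'a :: semiring_1 mat) = of_nat n"
  by (simp add: mat_trace_def)

lemma mat_trace_zero: "mat_trace (0\<^sub>m n n :: 'a :: semiring_1 mat) = 0"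
  by (simp add: mat_trace_def)

lemma mat_trace_four_block:
  assumes "A \<in> carrier_mat n n" "D \<in> carrier_mat m m"
  shows "mat_trace (four_block_mat A B C D) = mat_trace A + mat_trace D"
proof -
  have "mat_trace (four_block_mat A B C D)
      = (\<Sum>i<n + m. if i < n then A $$ (i, i) else D $$ (i - n, i - n))"
    using assms by (auto simp: mat_trace_def intro!: sum.cong)
  also have "\<dots> = (\<Sum>i<n. A $$ (i, i)) + (\<Sum>i<m. D $$ (i, i))"
    by (induction m) (simp_all add: add.assoc)
  finally show ?thesis using assms by (simp add: mat_trace_def)
qed

text \<open>The two products have equal trace, so \<open>n\<close> and \<open>m\<close> agree as
  scalars, and in characteristic 0 also as naturals.\<close>

lemma inverse_mats_imp_square:
  fixes A :: "'a :: {comm_semiring_1, semiring_char_0} mat"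
  assumes "A \<in> carrier_mat n m" "B \<in> carrier_mat m n" "A * B = 1\<^sub>m n" "B * A = 1\<^sub>m m"
  shows "n = m"
proof -
  have "mat_trace (1\<^sub>m n :: 'a mat) = mat_trace (1\<^sub>m m :: 'a mat)"
    using mat_trace_mult_commute[OF assms(1,2)] unfolding assms(3,4) .
  then show ?thesis unfolding mat_trace_one of_nat_eq_iff .
qed

lemma invertible_matI:
  assumes "A \<in> carrier_mat n n" "B \<in> carrier_mat n n" "A * B = 1\<^sub>m n" "B * A = 1\<^sub>m n"
  shows "invertible_mat A"
  using assms by (auto simp: invertible_mat_def inverts_mat_def)

text \<open>\<open>invertible_mat\<close> does not record the size of the inverse; counting the
  columns of the two identity products determines it.\<close>

lemma invertible_matE:
  assumes "invertible_mat A" "A \<in> carrier_mat n m"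
  obtains B where "n = m" "B \<in> carrier_mat n n" "A * B = 1\<^sub>m n" "B * A = 1\<^sub>m n"
proof -
  from assms(1) obtain B where "square_mat A" and inv: "inverts_mat A B" "inverts_mat B A"
    unfolding invertible_mat_def by blast
  with assms(2) have nm: "n = m"
    by (metis carrier_matD square_mat.simps)
  have AB: "A * B = 1\<^sub>m n" and BA: "B * A = 1\<^sub>m (dim_row B)"
    using inv assms(2) unfolding inverts_mat_def by auto
  have "dim_col B = n"
    using arg_cong[OF AB, of dim_col] by simp
  moreover have "dim_row B = n"
    using arg_cong[OF BA, of dim_col] assms(2) nm by simp
  ultimately have "B \<in> carrier_mat n n" by auto
  then show ?thesis using that nm AB BA by auto
qed

lemma four_block_mat_eqD:
  assumes eq: "four_block_mat A B C D = four_block_mat A' B' C' D'"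
    and "A \<in> carrier_mat n1 m1" "B \<in> carrier_mat n1 m2" "C \<in> carrier_mat n2 m1" "D \<in> carrier_mat n2 m2"
    and "A' \<in> carrier_mat n1 m1" "B' \<in> carrier_mat n1 m2" "C' \<in> carrier_mat n2 m1" "D' \<in> carrier_mat n2 m2"
  shows "A = A'" "B = B'" "C = C'" "D = D'"
proof -
  have *: "four_block_mat A B C D $$ (i, j) = four_block_mat A' B' C' D' $$ (i, j)" for i j
    using eq by simp
  show "A = A'"
  proof (rule eq_matI)
    fix i j assume "i < dim_row A'" "j < dim_col A'"
    then show "A $$ (i, j) = A' $$ (i, j)" using *[of i j] assms(2-) by auto
  qed (use assms in auto)
  show "B = B'"
  proof (rule eq_matI)
    fix i j assume "i < dim_row B'" "j < dim_col B'"
    then show "B $$ (i, j) = B' $$ (i, j)" using *[of i "j + m1"] assms(2-) by auto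
  qed (use assms in auto)
  show "C = C'"
  proof (rule eq_matI)
    fix i j assume "i < dim_row C'" "j < dim_col C'"
    then show "C $$ (i, j) = C' $$ (i, j)" using *[of "i + n1" j] assms(2-) by auto
  qed (use assms in auto)
  show "D = D'"
  proof (rule eq_matI)
    fix i j assume "i < dim_row D'" "j < dim_col D'"
    then show "D $$ (i, j) = D' $$ (i, j)" using *[of "i + n1" "j + m1"] assms(2-) by auto
  qed (use assms in auto)
qed

section \<open>Kronecker products\<close>

lemma sum_div_mod:
  fixes f :: "nat \<Rightarrow> nat \<Rightarrow> 'a :: comm_monoid_add"
  shows "(\<Sum>k<m * n. f (k div n) (k mod n)) = (\<Sum>i<m. \<Sum>j<n. f i j)"
proof -
  have "(\<Sum>k<m * n. f (k div n) (k mod n)) = (\<Sum>(i, j) \<in> {..<m} \<times> {..<n}. f i j)"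
  proof (rule sum.reindex_bij_witness[of _ "\<lambda>(i, j). i * n + j" "\<lambda>k. (k div n, k mod n)"])
    fix k assume k: "k \<in> {..<m * n}"
    then have "0 < n" by (cases n) auto
    then show "(k div n, k mod n) \<in> {..<m} \<times> {..<n}"
      using k by (auto simp: less_mult_imp_div_less)
  next
    fix x assume "x \<in> {..<m} \<times> {..<n}"
    then obtain i j where x: "x = (i, j)" "i < m" "j < n" by auto
    then have "i * n + j < (i + 1) * n" by simp
    also have "\<dots> \<le> m * n" using x by (intro mult_le_mono1) simp
    finally show "(case x of (i, j) \<Rightarrow> i * n + j) \<in> {..<m * n}" using x by simp
  qed auto
  then show ?thesis by (simp add: sum.cartesian_product)
qed

lemma kronecker_carrier [simp, intro]:
  "A \<in> carrier_mat n m \<Longrightarrow> B \<in> carrier_mat n' m' \<Longrightarrow> kronecker A B \<in> carrier_mat (n * n') (m * m')"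
  by (auto simp: kronecker_def)

lemma div_mod_bounds: "i < m * n \<Longrightarrow> i div n < m \<and> i mod n < (n :: nat)"
  by (cases n) (auto simp: less_mult_imp_div_less)

text \<open>The mixed-product rule. Quotient and remainder turn the inner summation index into a
  pair of indices, and the double sum factors into the two entries of the products.\<close>

lemma kronecker_mult:
  assumes "A \<in> carrier_mat n m" "B \<in> carrier_mat n' m'" "C \<in> carrier_mat m l" "D \<in> carrier_mat m' l'"
  shows "kronecker A B * kronecker C D = kronecker (A * C) (B * D)"
proof (rule eq_matI)
  fix i j assume "i < dim_row (kronecker (A * C) (B * D))" "j < dim_col (kronecker (A * C) (B * D))"
  then have ij: "i < n * n'" "j < l * l'"
    using assms by (auto simp: kronecker_def)
  note bd = div_mod_bounds[OF ij(1)] div_mod_bounds[OF ij(2)]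
  have "(kronecker A B * kronecker C D) $$ (i, j)
      = (\<Sum>k<m * m'. A $$ (i div n', k div m') * B $$ (i mod n', k mod m')
           * (C $$ (k div m', j div l') * D $$ (k mod m', j mod l')))"
    using ij assms by (auto simp: kronecker_def scalar_prod_def lessThan_atLeast0 intro!: sum.cong)
  also have "\<dots> = (\<Sum>k<m. \<Sum>k'<m'. A $$ (i div n', k) * B $$ (i mod n', k')
           * (C $$ (k, j div l') * D $$ (k', j mod l')))"
    by (rule sum_div_mod)
  also have "\<dots> = (\<Sum>k<m. A $$ (i div n', k) * C $$ (k, j div l'))
                * (\<Sum>k'<m'. B $$ (i mod n', k') * D $$ (k', j mod l'))"
    by (simp add: sum_product mult_ac)
  also have "\<dots> = kronecker (A * C) (B * D) $$ (i, j)"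
    using ij bd assms by (auto simp: kronecker_def scalar_prod_def lessThan_atLeast0)
  finally show "(kronecker A B * kronecker C D) $$ (i, j) = kronecker (A * C) (B * D) $$ (i, j)" .
qed (use assms in \<open>auto simp: kronecker_def\<close>)

lemma kronecker_one: "kronecker (1\<^sub>m n) (1\<^sub>m m) = 1\<^sub>m (n * m)"
proof (rule eq_matI)
  fix i j assume "i < dim_row (1\<^sub>m (n * m) :: complex mat)" "j < dim_col (1\<^sub>m (n * m) :: complex mat)"
  then have ij: "i < n * m" "j < n * m" by auto
  have "i = j" if "i div m = j div m" "i mod m = j mod m"
    using that by (metis div_mult_mod_eq)
  then show "kronecker (1\<^sub>m n) (1\<^sub>m m) $$ (i, j) = 1\<^sub>m (n * m) $$ (i, j)"
    using ij div_mod_bounds[OF ij(1)] div_mod_bounds[OF ij(2)] by (auto simp: kronecker_def)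
qed (auto simp: kronecker_def)

lemma kronecker_smult_right: "kronecker A (c \<cdot>\<^sub>m B) = c \<cdot>\<^sub>m kronecker A B"
proof (rule eq_matI)
  fix i j assume "i < dim_row (c \<cdot>\<^sub>m kronecker A B)" "j < dim_col (c \<cdot>\<^sub>m kronecker A B)"
  then have ij: "i < dim_row A * dim_row B" "j < dim_col A * dim_col B"
    by (auto simp: kronecker_def)
  then show "kronecker A (c \<cdot>\<^sub>m B) $$ (i, j) = (c \<cdot>\<^sub>m kronecker A B) $$ (i, j)"
    using div_mod_bounds[OF ij(1)] div_mod_bounds[OF ij(2)] by (auto simp: kronecker_def)
qed (auto simp: kronecker_def)

lemma diag_block_mat_smult:
  "diag_block_mat (map (\<lambda>A. c \<cdot>\<^sub>m A) As) = (c :: complex) \<cdot>\<^sub>m diag_block_mat As"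
proof (induction As)
  case (Cons A As)
  then show ?case
    by (simp add: Let_def) (subst smult_four_block_mat[of _ "dim_row A" "dim_col A" _ "dim_col (diag_block_mat As)" _ "dim_row (diag_block_mat As)"], auto)
qed auto

section \<open>Intertwiners and Schur's lemma\<close>

text \<open>Correct matrix sizes are what the calculus of isomorphisms, tensor products and direct
  sums rests on; the homomorphism law enters through \<open>group_rep\<close>.\<close>

definition mat_rep :: "('g, 'b) monoid_scheme \<Rightarrow> 'g rep \<Rightarrow> bool" where
  "mat_rep G \<tau> \<longleftrightarrow> (\<forall>g \<in> carrier G. rep_mat \<tau> g \<in> carrier_mat (rep_dim \<tau>) (rep_dim \<tau>))"

lemma mat_repD: "mat_rep G \<tau> \<Longrightarrow> g \<in> carrier G \<Longrightarrow> rep_mat \<tau> g \<in> carrier_mat (rep_dim \<tau>) (rep_dim \<tau>)"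
  by (auto simp: mat_rep_def)

text \<open>Eliminates the monoid records: a unit of the matrix ring is a matrix with a two-sided
  inverse of the same size.\<close>

lemma group_rep_iff:
  "group_rep G \<tau> \<longleftrightarrow>
     (\<forall>g \<in> carrier G. \<exists>B \<in> carrier_mat (rep_dim \<tau>) (rep_dim \<tau>).
        rep_mat \<tau> g \<in> carrier_mat (rep_dim \<tau>) (rep_dim \<tau>) \<and>
        B * rep_mat \<tau> g = 1\<^sub>m (rep_dim \<tau>) \<and> rep_mat \<tau> g * B = 1\<^sub>m (rep_dim \<tau>)) \<and>
     (\<forall>g \<in> carrier G. \<forall>h \<in> carrier G. rep_mat \<tau> (g \<otimes>\<^bsub>G\<^esub> h) = rep_mat \<tau> g * rep_mat \<tau> h)"
  unfolding group_rep_def hom_def GL_def units_of_def Units_def ring_mat_simps Pi_iff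
  by (simp; fast)

lemma group_rep_imp_mat_rep: "group_rep G \<tau> \<Longrightarrow> mat_rep G \<tau>"
  unfolding group_rep_iff mat_rep_def by blast

lemma irreducible_rep_imp_mat_rep: "irreducible_rep G \<tau> \<Longrightarrow> mat_rep G \<tau>"
  unfolding irreducible_rep_def by (blast intro: group_rep_imp_mat_rep)

definition intertwiner :: "('g, 'b) monoid_scheme \<Rightarrow> 'g rep \<Rightarrow> 'g rep \<Rightarrow> complex mat \<Rightarrow> bool" where
  "intertwiner G \<rho> \<tau> P \<longleftrightarrow> P \<in> carrier_mat (rep_dim \<tau>) (rep_dim \<rho>) \<and>
     (\<forall>g \<in> carrier G. P * rep_mat \<rho> g = rep_mat \<tau> g * P)"

lemma rep_iso_iff_intertwiner: "rep_iso G \<rho> \<tau> \<longleftrightarrow> (\<exists>P. intertwiner G \<rho> \<tau> P \<and> invertible_mat P)"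
  unfolding rep_iso_def intertwiner_def by blast

section \<open>Isomorphism of representations as an equivalence relation\<close>

lemma rep_iso_dim_eq: "rep_iso G \<rho> \<tau> \<Longrightarrow> rep_dim \<rho> = rep_dim \<tau>"
  unfolding rep_iso_def using invertible_matE by metis

text \<open>The identity matrix intertwines. Equality of the records would be too much to ask, since
  the matrices outside the carrier are arbitrary.\<close>

lemma rep_iso_cong:
  assumes "mat_rep G \<rho>" "rep_dim \<rho> = rep_dim \<tau>"
    and "\<And>g. g \<in> carrier G \<Longrightarrow> rep_mat \<rho> g = rep_mat \<tau> g"
  shows "rep_iso G \<rho> \<tau>"
proof -
  let ?I = "1\<^sub>m (rep_dim \<rho>) :: complex mat"
  have "?I * rep_mat \<rho> g = rep_mat \<tau> g * ?I" if "g \<in> carrier G" for g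
    using mat_repD[OF assms(1) that] assms(3)[OF that] by simp
  moreover have "invertible_mat ?I"
    by (rule invertible_matI[of _ "rep_dim \<rho>" ?I]) auto
  ultimately show ?thesis
    unfolding rep_iso_def using assms(2) by (intro bexI[of _ ?I]) auto
qed

lemma rep_iso_refl: "mat_rep G \<rho> \<Longrightarrow> rep_iso G \<rho> \<rho>"
  by (rule rep_iso_cong) auto

lemma rep_iso_sym:
  assumes iso: "rep_iso G \<rho> \<tau>" and \<rho>: "mat_rep G \<rho>" and \<tau>: "mat_rep G \<tau>"
  shows "rep_iso G \<tau> \<rho>"
proof -
  let ?n = "rep_dim \<rho>"
  have dim: "rep_dim \<tau> = ?n"
    using rep_iso_dim_eq[OF iso] by simp
  obtain P where P: "P \<in> carrier_mat ?n ?n" and "invertible_mat P"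
    and comm: "\<And>g. g \<in> carrier G \<Longrightarrow> P * rep_mat \<rho> g = rep_mat \<tau> g * P"
    using iso unfolding rep_iso_def dim by blast
  then obtain Q where Q: "Q \<in> carrier_mat ?n ?n" "P * Q = 1\<^sub>m ?n" "Q * P = 1\<^sub>m ?n"
    by (metis invertible_matE)
  have "Q * rep_mat \<tau> g = rep_mat \<rho> g * Q" if g: "g \<in> carrier G" for g
  proof -
    have R: "rep_mat \<rho> g \<in> carrier_mat ?n ?n" and T: "rep_mat \<tau> g \<in> carrier_mat ?n ?n"
      using mat_repD[OF \<rho> g] mat_repD[OF \<tau> g] by (auto simp: dim)
    have "Q * rep_mat \<tau> g = Q * (rep_mat \<tau> g * (P * Q))"
      using Q T by simp
    also have "\<dots> = Q * (rep_mat \<tau> g * P) * Q"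
      using P Q(1) T by (simp add: assoc_mult_mat[of _ ?n ?n _ ?n _ ?n])
    also have "\<dots> = (Q * P) * rep_mat \<rho> g * Q"
      unfolding comm[OF g, symmetric] using P Q(1) R by (simp add: assoc_mult_mat[of _ ?n ?n _ ?n _ ?n])
    finally show ?thesis using Q R by simp
  qed
  moreover have "invertible_mat Q"
    using Q P by (intro invertible_matI[of Q ?n P])
  ultimately show ?thesis
    unfolding rep_iso_def dim using Q by blast
qed

lemma rep_iso_trans:
  assumes iso: "rep_iso G \<rho> \<tau>" "rep_iso G \<tau> \<sigma>"
    and reps: "mat_rep G \<rho>" "mat_rep G \<tau>" "mat_rep G \<sigma>"
  shows "rep_iso G \<rho> \<sigma>"
proof -
  let ?n = "rep_dim \<rho>"
  have dim: "rep_dim \<tau> = ?n" "rep_dim \<sigma> = ?n"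
    using iso rep_iso_dim_eq by metis+
  obtain P where P: "P \<in> carrier_mat ?n ?n" and "invertible_mat P"
    and commP: "\<And>g. g \<in> carrier G \<Longrightarrow> P * rep_mat \<rho> g = rep_mat \<tau> g * P"
    using iso(1) unfolding rep_iso_def dim by blast
  obtain Q where Q: "Q \<in> carrier_mat ?n ?n" and "invertible_mat Q"
    and commQ: "\<And>g. g \<in> carrier G \<Longrightarrow> Q * rep_mat \<tau> g = rep_mat \<sigma> g * Q"
    using iso(2) unfolding rep_iso_def dim by blast
  obtain P' where P': "P' \<in> carrier_mat ?n ?n" "P * P' = 1\<^sub>m ?n" "P' * P = 1\<^sub>m ?n"
    using P \<open>invertible_mat P\<close> by (metis invertible_matE)
  obtain Q' where Q': "Q' \<in> carrier_mat ?n ?n" "Q * Q' = 1\<^sub>m ?n" "Q' * Q = 1\<^sub>m ?n"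
    using Q \<open>invertible_mat Q\<close> by (metis invertible_matE)
  note assoc = assoc_mult_mat[of _ ?n ?n _ ?n _ ?n]
  have "Q * P * rep_mat \<rho> g = rep_mat \<sigma> g * (Q * P)" if g: "g \<in> carrier G" for g
  proof -
    have R: "rep_mat \<rho> g \<in> carrier_mat ?n ?n" "rep_mat \<tau> g \<in> carrier_mat ?n ?n" "rep_mat \<sigma> g \<in> carrier_mat ?n ?n"
      using reps g by (auto dest!: mat_repD simp: dim)
    have "Q * P * rep_mat \<rho> g = Q * (rep_mat \<tau> g * P)"
      using P Q R by (simp add: assoc commP[OF g])
    also have "\<dots> = (rep_mat \<sigma> g * Q) * P"
      using P Q R by (simp add: assoc commQ[OF g, symmetric])
    finally show ?thesis using P Q R by (simp add: assoc)
  qed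
  moreover have "invertible_mat (Q * P)"
  proof (rule invertible_matI)
    show "Q * P \<in> carrier_mat ?n ?n" "P' * Q' \<in> carrier_mat ?n ?n"
      using P Q P' Q' by auto
    have "Q * P * (P' * Q') = Q * (P * P') * Q'" "P' * Q' * (Q * P) = P' * (Q' * Q) * P"
      using P Q P'(1) Q'(1) by (simp_all add: assoc)
    then show "Q * P * (P' * Q') = 1\<^sub>m ?n" "P' * Q' * (Q * P) = 1\<^sub>m ?n"
      using P Q P' Q' by simp_all
  qed
  ultimately show ?thesis
    unfolding rep_iso_def dim using P Q by (intro bexI[of _ "Q * P"]) auto
qed

section \<open>Invariant subspaces and Schur's lemma\<close>

lemma vec_subspaceI:
  assumes "W \<subseteq> carrier_vec n" "0\<^sub>v n \<in> W"
    and "\<And>v w. v \<in> W \<Longrightarrow> w \<in> W \<Longrightarrow> v + w \<in> W" "\<And>c v. v \<in> W \<Longrightarrow> c \<cdot>\<^sub>v v \<in> W"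
  shows "VectorSpace.subspace class_ring W (module_vec TYPE('a :: field) n)"
  unfolding VectorSpace.subspace_def submodule_def
  using assms vec_vs vec_module by (auto simp: module_vec_simps)

lemma vec_subspace_smult_closed:
  assumes "VectorSpace.subspace class_ring W (module_vec TYPE('a :: field) n)" "v \<in> W"
  shows "c \<cdot>\<^sub>v v \<in> W"
  using assms unfolding VectorSpace.subspace_def submodule_def by (auto simp: module_vec_simps)

lemma irreducible_repD:
  assumes "irreducible_rep G \<tau>" "W \<subseteq> carrier_vec (rep_dim \<tau>)" "0\<^sub>v (rep_dim \<tau>) \<in> W"
    and "\<And>v w. v \<in> W \<Longrightarrow> w \<in> W \<Longrightarrow> v + w \<in> W" "\<And>c v. v \<in> W \<Longrightarrow> c \<cdot>\<^sub>v v \<in> W"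
    and "\<And>g w. g \<in> carrier G \<Longrightarrow> w \<in> W \<Longrightarrow> rep_mat \<tau> g *\<^sub>v w \<in> W"
  shows "W = {0\<^sub>v (rep_dim \<tau>)} \<or> W = carrier_vec (rep_dim \<tau>)"
  using assms(1) vec_subspaceI[OF assms(2-5)] assms(6) unfolding irreducible_rep_def by blast

lemma mult_mat_unit_vec:
  fixes A :: "'a :: semiring_1 mat"
  assumes "A \<in> carrier_mat n m" "j < m"
  shows "A *\<^sub>v unit_vec m j = col A j"
  using col_mult2[OF assms(1) one_carrier_mat assms(2)] assms by simp

text \<open>The kernel of an intertwiner is an invariant subspace of the source, so irreducibility
  leaves only zero or everything.\<close>

lemma intertwiner_kernel:
  assumes \<sigma>: "irreducible_rep G \<sigma>" and \<tau>: "mat_rep G \<tau>" and P: "intertwiner G \<sigma> \<tau> P"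
  shows "mat_kernel P = {0\<^sub>v (rep_dim \<sigma>)} \<or> P = 0\<^sub>m (rep_dim \<tau>) (rep_dim \<sigma>)"
proof -
  let ?n = "rep_dim \<sigma>" and ?m = "rep_dim \<tau>"
  have P: "P \<in> carrier_mat ?m ?n" and comm: "\<And>g. g \<in> carrier G \<Longrightarrow> P * rep_mat \<sigma> g = rep_mat \<tau> g * P"
    using assms by (auto simp: intertwiner_def)
  have "mat_kernel P = {0\<^sub>v ?n} \<or> mat_kernel P = carrier_vec ?n"
  proof (rule irreducible_repD[OF \<sigma>])
    fix g w assume g: "g \<in> carrier G" and "w \<in> mat_kernel P"
    then have w: "w \<in> carrier_vec ?n" "P *\<^sub>v w = 0\<^sub>v ?m"
      using mat_kernelD[OF P] by auto
    have S: "rep_mat \<sigma> g \<in> carrier_mat ?n ?n" and T: "rep_mat \<tau> g \<in> carrier_mat ?m ?m"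
      using g \<tau> irreducible_rep_imp_mat_rep[OF \<sigma>] by (auto dest: mat_repD)
    have "P *\<^sub>v (rep_mat \<sigma> g *\<^sub>v w) = (rep_mat \<tau> g * P) *\<^sub>v w"
      unfolding comm[OF g, symmetric] using P S w by (simp add: assoc_mult_mat_vec)
    also have "\<dots> = rep_mat \<tau> g *\<^sub>v (P *\<^sub>v w)"
      using T P w(1) by (rule assoc_mult_mat_vec)
    also have "\<dots> = 0\<^sub>v ?m"
      using T by (auto simp: w(2) intro!: eq_vecI)
    finally show "rep_mat \<sigma> g *\<^sub>v w \<in> mat_kernel P"
      using S w by (intro mat_kernelI[OF P]) auto
  next
    show "0\<^sub>v ?n \<in> mat_kernel P"
      using P by (intro mat_kernelI[OF P]) (auto intro!: eq_vecI)
  next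
    fix v w assume "v \<in> mat_kernel P" "w \<in> mat_kernel P"
    then show "v + w \<in> mat_kernel P"
      using P by (auto simp: mat_kernel[OF P] mult_add_distrib_mat_vec[OF P])
  qed (use mat_kernel_carrier[OF P] mat_kernel_smult[OF P] in auto)
  \<comment> \<open>Applying \<open>P\<close> to a unit vector reads off a column, so a matrix that
    kills all vectors has zero columns.\<close>
  moreover have "P = 0\<^sub>m ?m ?n" if "mat_kernel P = carrier_vec ?n"
  proof (rule eq_matI)
    fix i j assume ij: "i < dim_row (0\<^sub>m ?m ?n :: complex mat)" "j < dim_col (0\<^sub>m ?m ?n :: complex mat)"
    have uv: "unit_vec ?n j \<in> mat_kernel P"
      using that by simp
    have "col P j = 0\<^sub>v ?m"
      using mat_kernelD(2)[OF P uv] mult_mat_unit_vec[OF P] ij by simp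
    then show "P $$ (i, j) = 0\<^sub>m ?m ?n $$ (i, j)"
      using P ij by (metis carrier_matD index_col index_zero_mat index_zero_vec(1))
  qed (use P in auto)
  ultimately show ?thesis by blast
qed

text \<open>Dual to the kernel argument: the image is an invariant subspace of the irreducible
  target.\<close>

lemma intertwiner_image:
  assumes \<sigma>: "mat_rep G \<sigma>" and \<tau>: "irreducible_rep G \<tau>" and P: "intertwiner G \<sigma> \<tau> P"
  shows "(\<lambda>v. P *\<^sub>v v) ` carrier_vec (rep_dim \<sigma>) = carrier_vec (rep_dim \<tau>) \<or>
         P = 0\<^sub>m (rep_dim \<tau>) (rep_dim \<sigma>)"
proof -
  let ?n = "rep_dim \<sigma>" and ?m = "rep_dim \<tau>"
  let ?W = "(\<lambda>v. P *\<^sub>v v) ` carrier_vec ?n"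
  have P: "P \<in> carrier_mat ?m ?n" and comm: "\<And>g. g \<in> carrier G \<Longrightarrow> P * rep_mat \<sigma> g = rep_mat \<tau> g * P"
    using assms by (auto simp: intertwiner_def)
  have "?W = {0\<^sub>v ?m} \<or> ?W = carrier_vec ?m"
  proof (rule irreducible_repD[OF \<tau>])
    fix g w assume g: "g \<in> carrier G" and "w \<in> ?W"
    then obtain v where v: "v \<in> carrier_vec ?n" "w = P *\<^sub>v v" by auto
    have S: "rep_mat \<sigma> g \<in> carrier_mat ?n ?n" and T: "rep_mat \<tau> g \<in> carrier_mat ?m ?m"
      using g \<sigma> irreducible_rep_imp_mat_rep[OF \<tau>] by (auto dest: mat_repD)
    have "rep_mat \<tau> g *\<^sub>v w = (rep_mat \<tau> g * P) *\<^sub>v v"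
      unfolding v(2) using T P v(1) by (rule assoc_mult_mat_vec[symmetric])
    also have "\<dots> = P *\<^sub>v (rep_mat \<sigma> g *\<^sub>v v)"
      unfolding comm[OF g, symmetric] using P S v(1) by (rule assoc_mult_mat_vec)
    finally show "rep_mat \<tau> g *\<^sub>v w \<in> ?W"
      using S v by auto
  next
    show "0\<^sub>v ?m \<in> ?W"
      using P by (intro image_eqI[of _ _ "0\<^sub>v ?n"]) (auto intro!: eq_vecI)
  next
    fix v w assume "v \<in> ?W" "w \<in> ?W"
    then obtain v' w' where "v' \<in> carrier_vec ?n" "w' \<in> carrier_vec ?n" "v = P *\<^sub>v v'" "w = P *\<^sub>v w'"
      by auto
    then show "v + w \<in> ?W"
      using P by (intro image_eqI[of _ _ "v' + w'"]) (auto simp: mult_add_distrib_mat_vec[OF P])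
  next
    fix c v assume "v \<in> ?W"
    then obtain v' where "v' \<in> carrier_vec ?n" "v = P *\<^sub>v v'"
      by auto
    then show "c \<cdot>\<^sub>v v \<in> ?W"
      using P by (intro image_eqI[of _ _ "c \<cdot>\<^sub>v v'"]) (auto simp: mult_mat_vec[OF P])
  qed (use P in auto)
  moreover have "P = 0\<^sub>m ?m ?n" if "?W = {0\<^sub>v ?m}"
  proof (rule eq_matI)
    fix i j assume ij: "i < dim_row (0\<^sub>m ?m ?n :: complex mat)" "j < dim_col (0\<^sub>m ?m ?n :: complex mat)"
    have "P *\<^sub>v unit_vec ?n j \<in> ?W"
      by simp
    then have "col P j = 0\<^sub>v ?m"
      using that P ij by (simp add: mult_mat_unit_vec)
    then show "P $$ (i, j) = 0\<^sub>m ?m ?n $$ (i, j)"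
      using P ij by (metis carrier_matD index_col index_zero_mat index_zero_vec(1))
  qed (use P in auto)
  ultimately show ?thesis by blast
qed

text \<open>A nonzero intertwiner has zero kernel and full image. From these a two-sided inverse is
  built column by column, and squareness is deduced at the end.\<close>

lemma schur:
  assumes \<sigma>: "irreducible_rep G \<sigma>" and \<tau>: "irreducible_rep G \<tau>" and P: "intertwiner G \<sigma> \<tau> P"
  shows "P = 0\<^sub>m (rep_dim \<tau>) (rep_dim \<sigma>) \<or> invertible_mat P"
proof (cases "P = 0\<^sub>m (rep_dim \<tau>) (rep_dim \<sigma>)")
  case False
  then have nz: "P \<noteq> 0\<^sub>m (rep_dim \<tau>) (rep_dim \<sigma>)" .
  let ?n = "rep_dim \<sigma>" and ?m = "rep_dim \<tau>"
  have Pc: "P \<in> carrier_mat ?m ?n" using P by (simp add: intertwiner_def)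
  have ker: "mat_kernel P = {0\<^sub>v ?n}"
    using intertwiner_kernel[OF \<sigma> irreducible_rep_imp_mat_rep[OF \<tau>] P] nz by simp
  have im: "(\<lambda>v. P *\<^sub>v v) ` carrier_vec ?n = carrier_vec ?m"
    using intertwiner_image[OF irreducible_rep_imp_mat_rep[OF \<sigma>] \<tau> P] nz by simp
  \<comment> \<open>Surjectivity: chosen preimages of the unit vectors become the columns of a right
    inverse \<open>Q\<close>.\<close>
  have "\<exists>v \<in> carrier_vec ?n. P *\<^sub>v v = unit_vec ?m j" for j
    using im by (metis image_iff unit_vec_carrier)
  then obtain q where q: "\<And>j. q j \<in> carrier_vec ?n" "\<And>j. P *\<^sub>v q j = unit_vec ?m j"
    by metis
  define Q where "Q = mat_of_cols ?n (map q [0..<?m])"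
  have Q: "Q \<in> carrier_mat ?n ?m" using mat_of_cols_carrier(1)[of ?n "map q [0..<?m]"] by (simp add: Q_def)
  have colQ: "col Q j = q j" if "j < ?m" for j
    using that q(1) by (simp add: Q_def)
  have PQ: "P * Q = 1\<^sub>m ?m"
  proof (rule mat_col_eqI)
    fix j assume "j < dim_col (1\<^sub>m ?m :: complex mat)"
    then have j: "j < ?m" by simp
    show "col (P * Q) j = col (1\<^sub>m ?m) j"
      unfolding col_mult2[OF Pc Q j] colQ[OF j] q(2) col_one[OF j] ..
  qed (use Pc Q in auto)
  have inj: "v = w" if "v \<in> carrier_vec ?n" "w \<in> carrier_vec ?n" "P *\<^sub>v v = P *\<^sub>v w" for v w
  proof -
    have "P *\<^sub>v (v - w) = 0\<^sub>v ?m"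
      using that Pc by (simp add: mult_minus_distrib_mat_vec[OF Pc])
    then have "v - w \<in> mat_kernel P"
      using that by (intro mat_kernelI[OF Pc]) auto
    then have vw: "v - w = 0\<^sub>v ?n" using ker by simp
    have "v = (v - w) + w"
      using that by (intro eq_vecI) auto
    then show ?thesis using vw that by simp
  qed
  \<comment> \<open>Since \<open>P * Q\<close> is the identity, \<open>Q * P\<close> and the
    identity agree after applying \<open>P\<close> to their columns, and \<open>P\<close> is
    injective.\<close>
  have QP: "Q * P = 1\<^sub>m ?n"
  proof (rule mat_col_eqI)
    fix j assume "j < dim_col (1\<^sub>m ?n :: complex mat)"
    then have j: "j < ?n" by simp
    have col: "col P j \<in> carrier_vec ?m" using Pc j by auto
    have "P *\<^sub>v (Q *\<^sub>v col P j) = (P * Q) *\<^sub>v col P j"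
      by (rule assoc_mult_mat_vec[OF Pc Q col, symmetric])
    also have "\<dots> = P *\<^sub>v unit_vec ?n j"
      unfolding PQ one_mult_mat_vec[OF col] mult_mat_unit_vec[OF Pc j] ..
    finally have "Q *\<^sub>v col P j = unit_vec ?n j"
      by (rule inj[OF mult_mat_vec_carrier[OF Q col] unit_vec_carrier])
    then show "col (Q * P) j = col (1\<^sub>m ?n) j"
      unfolding col_mult2[OF Q Pc j] col_one[OF j] .
  qed (use Pc Q in auto)
  have "?m = ?n"
    using Pc Q PQ QP by (rule inverse_mats_imp_square)
  then show ?thesis
    using Pc Q PQ QP by (intro disjI2 invertible_matI) auto
qed simp

section \<open>Uniqueness of multiplicities\<close>

text \<open>Naturality of the pair \<open>E\<close>, \<open>F\<close>, which in use are isotypic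
  projections. For an invertible intertwiner it makes \<open>E\<close> and \<open>F\<close>
  conjugate.\<close>

definition intertwiners_commute ::
  "('g, 'b) monoid_scheme \<Rightarrow> 'g rep \<Rightarrow> complex mat \<Rightarrow> 'g rep \<Rightarrow> complex mat \<Rightarrow> bool" where
  "intertwiners_commute G \<rho> E \<tau> F \<longleftrightarrow> (\<forall>P. intertwiner G \<rho> \<tau> P \<longrightarrow> P * E = F * P)"

lemma direct_sum_rep_Nil: "rep_dim (direct_sum_rep []) = 0"
  by (simp add: direct_sum_rep_def)

lemma direct_sum_rep_singleton: "direct_sum_rep [\<tau>] = \<tau>"
  unfolding direct_sum_rep_def list.map diag_block_mat_singleton by simp

lemma rep_dim_direct_sum_Cons:
  "rep_dim (direct_sum_rep (\<tau> # L)) = rep_dim \<tau> + rep_dim (direct_sum_rep L)"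
  by (simp add: direct_sum_rep_def)

lemma mat_rep_direct_sum:
  assumes "\<And>\<tau>. \<tau> \<in> set L \<Longrightarrow> mat_rep G \<tau>"
  shows "mat_rep G (direct_sum_rep L)"
  using assms
proof (induction L)
  case (Cons \<tau> L)
  then have "mat_rep G \<tau>" "mat_rep G (direct_sum_rep L)" by auto
  then show ?case
    unfolding mat_rep_def rep_dim_direct_sum_Cons
    by (auto simp: direct_sum_rep_def Let_def)
qed (auto simp: mat_rep_def direct_sum_rep_def)

lemma rep_mat_direct_sum_Cons:
  assumes "mat_rep G \<tau>" "mat_rep G (direct_sum_rep L)" "g \<in> carrier G"
  shows "rep_mat (direct_sum_rep (\<tau> # L)) g =
    four_block_mat (rep_mat \<tau> g) (0\<^sub>m (rep_dim \<tau>) (rep_dim (direct_sum_rep L)))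
      (0\<^sub>m (rep_dim (direct_sum_rep L)) (rep_dim \<tau>)) (rep_mat (direct_sum_rep L) g)"
  using mat_repD[OF assms(1,3)] mat_repD[OF assms(2,3)]
  by (auto simp: direct_sum_rep_def Let_def)

text \<open>An intertwiner between sums splits into four blocks, each of which intertwines a summand
  of the source with one of the target. Against block diagonal \<open>E\<close> and \<open>F\<close>
  the commutation is checked block by block.\<close>

lemma intertwiners_commute_direct_sum_Cons:
  assumes reps: "mat_rep G \<rho>" "mat_rep G (direct_sum_rep L)" "mat_rep G \<tau>" "mat_rep G (direct_sum_rep M)"
    and E: "E \<in> carrier_mat (rep_dim \<rho>) (rep_dim \<rho>)"
      "E' \<in> carrier_mat (rep_dim (direct_sum_rep L)) (rep_dim (direct_sum_rep L))"
    and F: "F \<in> carrier_mat (rep_dim \<tau>) (rep_dim \<tau>)"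
      "F' \<in> carrier_mat (rep_dim (direct_sum_rep M)) (rep_dim (direct_sum_rep M))"
    and resp: "intertwiners_commute G \<rho> E \<tau> F" "intertwiners_commute G (direct_sum_rep L) E' \<tau> F"
      "intertwiners_commute G \<rho> E (direct_sum_rep M) F'" "intertwiners_commute G (direct_sum_rep L) E' (direct_sum_rep M) F'"
  shows "intertwiners_commute G
    (direct_sum_rep (\<rho> # L)) (four_block_mat E (0\<^sub>m (dim_row E) (dim_col E')) (0\<^sub>m (dim_row E') (dim_col E)) E')
    (direct_sum_rep (\<tau> # M)) (four_block_mat F (0\<^sub>m (dim_row F) (dim_col F')) (0\<^sub>m (dim_row F') (dim_col F)) F')"
  unfolding intertwiners_commute_def
proof (intro allI impI)
  define n n' m m' where dims: "n = rep_dim \<rho>" "n' = rep_dim (direct_sum_rep L)"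
    "m = rep_dim \<tau>" "m' = rep_dim (direct_sum_rep M)"
  fix P assume P: "intertwiner G (direct_sum_rep (\<rho> # L)) (direct_sum_rep (\<tau> # M)) P"
  then have Pc: "dim_row P = m + m'" "dim_col P = n + n'"
    by (auto simp: intertwiner_def rep_dim_direct_sum_Cons dims)
  obtain P1 P2 P3 P4 where spl: "split_block P m n = (P1, P2, P3, P4)"
    by (metis prod_cases4)
  note blk = split_block(1-4)[OF spl Pc] and P_eq = split_block(5)[OF spl Pc]
  \<comment> \<open>A block diagonal factor acts on block columns from the right and, in
    \<open>left\<close>, on block rows from the left. Both forms serve twice: for the representation
    matrices and for the projections.\<close>
  have right: "P * four_block_mat X (0\<^sub>m n n') (0\<^sub>m n' n) X' = four_block_mat (P1 * X) (P2 * X') (P3 * X) (P4 * X')"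
    if "X \<in> carrier_mat n n" "X' \<in> carrier_mat n' n'" for X X'
    unfolding P_eq using blk that
    by (subst mult_four_block_mat[of P1 m n P2 n' P3 m' P4 X n _ n' _ X']) auto
  have left: "four_block_mat Y (0\<^sub>m m m') (0\<^sub>m m' m) Y' * P = four_block_mat (Y * P1) (Y * P2) (Y' * P3) (Y' * P4)"
    if "Y \<in> carrier_mat m m" "Y' \<in> carrier_mat m' m'" for Y Y'
    unfolding P_eq using blk that
    by (subst mult_four_block_mat[of Y m m _ m' _ m' Y' P1 n P2 n' P3 P4]) auto
  have "P1 * rep_mat \<rho> g = rep_mat \<tau> g * P1 \<and> P2 * rep_mat (direct_sum_rep L) g = rep_mat \<tau> g * P2
     \<and> P3 * rep_mat \<rho> g = rep_mat (direct_sum_rep M) g * P3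
     \<and> P4 * rep_mat (direct_sum_rep L) g = rep_mat (direct_sum_rep M) g * P4" if g: "g \<in> carrier G" for g
  proof -
    have c: "rep_mat \<rho> g \<in> carrier_mat n n" "rep_mat (direct_sum_rep L) g \<in> carrier_mat n' n'"
      "rep_mat \<tau> g \<in> carrier_mat m m" "rep_mat (direct_sum_rep M) g \<in> carrier_mat m' m'"
      unfolding dims using reps g by (auto intro: mat_repD)
    have "P * rep_mat (direct_sum_rep (\<rho> # L)) g = rep_mat (direct_sum_rep (\<tau> # M)) g * P"
      using P g by (auto simp: intertwiner_def)
    then have "four_block_mat (P1 * rep_mat \<rho> g) (P2 * rep_mat (direct_sum_rep L) g)
          (P3 * rep_mat \<rho> g) (P4 * rep_mat (direct_sum_rep L) g)
        = four_block_mat (rep_mat \<tau> g * P1) (rep_mat \<tau> g * P2)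
          (rep_mat (direct_sum_rep M) g * P3) (rep_mat (direct_sum_rep M) g * P4)"
      unfolding rep_mat_direct_sum_Cons[OF reps(1,2) g] rep_mat_direct_sum_Cons[OF reps(3,4) g]
        dims[symmetric] right[OF c(1,2)] left[OF c(3,4)] .
    note four_block_mat_eqD[OF this, of m n n' m']
    then show ?thesis using c blk by auto
  qed
  then have "intertwiner G \<rho> \<tau> P1" "intertwiner G (direct_sum_rep L) \<tau> P2"
    "intertwiner G \<rho> (direct_sum_rep M) P3" "intertwiner G (direct_sum_rep L) (direct_sum_rep M) P4"
    unfolding intertwiner_def using blk by (auto simp: dims)
  then have "P1 * E = F * P1" "P2 * E' = F * P2" "P3 * E = F' * P3" "P4 * E' = F' * P4"
    using resp by (auto simp: intertwiners_commute_def)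
  then show "P * four_block_mat E (0\<^sub>m (dim_row E) (dim_col E')) (0\<^sub>m (dim_row E') (dim_col E)) E'
     = four_block_mat F (0\<^sub>m (dim_row F) (dim_col F')) (0\<^sub>m (dim_row F') (dim_col F)) F' * P"
    using E F right[of E E'] left[of F F'] by (simp add: dims)
qed

definition isotypic_proj :: "('g, 'b) monoid_scheme \<Rightarrow> 'g rep \<Rightarrow> 'g rep list \<Rightarrow> complex mat" where
  "isotypic_proj G \<phi> L = diag_block_mat
     (map (\<lambda>\<tau>. if rep_iso G \<tau> \<phi> then 1\<^sub>m (rep_dim \<tau>) else 0\<^sub>m (rep_dim \<tau>) (rep_dim \<tau>)) L)"

lemma isotypic_proj_carrier:
  "isotypic_proj G \<phi> L \<in> carrier_mat (rep_dim (direct_sum_rep L)) (rep_dim (direct_sum_rep L))"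
  by (induction L) (auto simp: isotypic_proj_def direct_sum_rep_def Let_def)

lemma isotypic_proj_singleton:
  "isotypic_proj G \<phi> [\<tau>] = (if rep_iso G \<tau> \<phi> then 1\<^sub>m (rep_dim \<tau>) else 0\<^sub>m (rep_dim \<tau>) (rep_dim \<tau>))"
  unfolding isotypic_proj_def list.map diag_block_mat_singleton ..

text \<open>The upper block is written as \<open>isotypic_proj G \<phi> [\<tau>]\<close> to match
  the shape of \<open>intertwiners_commute_direct_sum_Cons\<close>.\<close>

lemma isotypic_proj_Cons:
  "isotypic_proj G \<phi> (\<tau> # L) = four_block_mat (isotypic_proj G \<phi> [\<tau>])
     (0\<^sub>m (dim_row (isotypic_proj G \<phi> [\<tau>])) (dim_col (isotypic_proj G \<phi> L)))
     (0\<^sub>m (dim_row (isotypic_proj G \<phi> L)) (dim_col (isotypic_proj G \<phi> [\<tau>]))) (isotypic_proj G \<phi> L)"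
  unfolding isotypic_proj_singleton unfolding isotypic_proj_def list.map diag_block_mat.simps Let_def ..

text \<open>By Schur's lemma \<open>P\<close> is zero or an isomorphism. In the second case
  \<open>\<rho>\<close> and \<open>\<tau>\<close> have the same type, so both projections are the
  identity or both are zero.\<close>

lemma intertwiners_commute_irreducible:
  assumes \<rho>: "irreducible_rep G \<rho>" and \<tau>: "irreducible_rep G \<tau>" and \<phi>: "irreducible_rep G \<phi>"
  shows "intertwiners_commute G \<rho> (isotypic_proj G \<phi> [\<rho>]) \<tau> (isotypic_proj G \<phi> [\<tau>])"
  unfolding intertwiners_commute_def
proof (intro allI impI)
  fix P assume P: "intertwiner G \<rho> \<tau> P"
  then have Pc: "P \<in> carrier_mat (rep_dim \<tau>) (rep_dim \<rho>)" by (simp add: intertwiner_def)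
  note mr = irreducible_rep_imp_mat_rep[OF \<rho>] irreducible_rep_imp_mat_rep[OF \<tau>] irreducible_rep_imp_mat_rep[OF \<phi>]
  from schur[OF \<rho> \<tau> P] show "P * isotypic_proj G \<phi> [\<rho>] = isotypic_proj G \<phi> [\<tau>] * P"
  proof
    assume "P = 0\<^sub>m (rep_dim \<tau>) (rep_dim \<rho>)"
    then show ?thesis by (simp add: isotypic_proj_singleton)
  next
    assume "invertible_mat P"
    then have "rep_iso G \<rho> \<tau>" using P by (auto simp: rep_iso_iff_intertwiner)
    then have "rep_iso G \<rho> \<phi> \<longleftrightarrow> rep_iso G \<tau> \<phi>"
      using rep_iso_trans rep_iso_sym mr by metis
    then show ?thesis using Pc by (simp add: isotypic_proj_singleton)
  qed
qed

text \<open>Both sides are matrices without rows or without columns. This covers the empty direct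
  sum in the inductions.\<close>

lemma intertwiners_commute_empty:
  assumes "rep_dim \<rho> = 0 \<or> rep_dim \<tau> = 0"
    and "E \<in> carrier_mat (rep_dim \<rho>) (rep_dim \<rho>)" "F \<in> carrier_mat (rep_dim \<tau>) (rep_dim \<tau>)"
  shows "intertwiners_commute G \<rho> E \<tau> F"
  unfolding intertwiners_commute_def intertwiner_def using assms by (auto intro!: eq_matI)

text \<open>Two inductions: \<open>single\<close> lets the target list grow for one irreducible
  source, then the source list grows. The block lemma wants a first summand on both sides, so the
  side that is not split is padded with an empty sum.\<close>

lemma intertwiners_commute_isotypic_proj:
  assumes L: "\<And>\<tau>. \<tau> \<in> set L \<Longrightarrow> irreducible_rep G \<tau>"
    and M: "\<And>\<tau>. \<tau> \<in> set M \<Longrightarrow> irreducible_rep G \<tau>"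
    and \<phi>: "irreducible_rep G \<phi>"
  shows "intertwiners_commute G (direct_sum_rep L) (isotypic_proj G \<phi> L) (direct_sum_rep M) (isotypic_proj G \<phi> M)"
proof -
  note carrier = isotypic_proj_carrier[of G \<phi>]
  have carrier1: "isotypic_proj G \<phi> [\<tau>] \<in> carrier_mat (rep_dim \<tau>) (rep_dim \<tau>)" for \<tau>
    using carrier[of "[\<tau>]"] unfolding direct_sum_rep_singleton .
  have rep: "mat_rep G (direct_sum_rep N)" if "\<And>\<tau>. \<tau> \<in> set N \<Longrightarrow> irreducible_rep G \<tau>" for N
    using that by (intro mat_rep_direct_sum irreducible_rep_imp_mat_rep)
  have rep0: "mat_rep G (direct_sum_rep [])"
    by (rule rep) simp
  have single: "intertwiners_commute G \<rho> (isotypic_proj G \<phi> [\<rho>]) (direct_sum_rep N) (isotypic_proj G \<phi> N)"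
    if \<rho>: "irreducible_rep G \<rho>" and "\<And>\<tau>. \<tau> \<in> set N \<Longrightarrow> irreducible_rep G \<tau>" for \<rho> N
    using that(2)
  proof (induction N)
    case Nil
    show ?case
      by (rule intertwiners_commute_empty[OF _ carrier1 carrier]) (simp add: direct_sum_rep_Nil)
  next
    case (Cons \<tau> N)
    then have \<tau>: "irreducible_rep G \<tau>" and N: "\<And>\<tau>. \<tau> \<in> set N \<Longrightarrow> irreducible_rep G \<tau>"
      by simp_all
    \<comment> \<open>The source \<open>\<rho>\<close> is viewed as the sum of
      \<open>[\<rho>]\<close>, with \<open>?E'\<close> as an empty second diagonal block.\<close>
    let ?E = "isotypic_proj G \<phi> [\<rho>]" and ?E' = "isotypic_proj G \<phi> []"
    have "intertwiners_commute G (direct_sum_rep [\<rho>])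
       (four_block_mat ?E (0\<^sub>m (dim_row ?E) (dim_col ?E')) (0\<^sub>m (dim_row ?E') (dim_col ?E)) ?E')
       (direct_sum_rep (\<tau> # N)) (isotypic_proj G \<phi> (\<tau> # N))"
      unfolding isotypic_proj_Cons[of G \<phi> \<tau> N]
    proof (rule intertwiners_commute_direct_sum_Cons)
      show "intertwiners_commute G (direct_sum_rep []) (isotypic_proj G \<phi> []) \<tau> (isotypic_proj G \<phi> [\<tau>])"
        by (rule intertwiners_commute_empty[OF _ carrier carrier1]) (simp add: direct_sum_rep_Nil)
      show "intertwiners_commute G (direct_sum_rep []) (isotypic_proj G \<phi> [])
          (direct_sum_rep N) (isotypic_proj G \<phi> N)"
        by (rule intertwiners_commute_empty[OF _ carrier carrier]) (simp add: direct_sum_rep_Nil)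
      show "intertwiners_commute G \<rho> (isotypic_proj G \<phi> [\<rho>]) (direct_sum_rep N) (isotypic_proj G \<phi> N)"
        using N by (rule Cons.IH)
      show "mat_rep G (direct_sum_rep N)"
        using N by (rule rep)
    qed (fact carrier carrier1 rep0 irreducible_rep_imp_mat_rep[OF \<rho>] irreducible_rep_imp_mat_rep[OF \<tau>]
        intertwiners_commute_irreducible[OF \<rho> \<tau> \<phi>])+
    then show ?case unfolding isotypic_proj_Cons[symmetric] direct_sum_rep_singleton .
  qed
  show ?thesis
    using L
  proof (induction L)
    case Nil
    show ?case
      by (rule intertwiners_commute_empty[OF _ carrier carrier]) (simp add: direct_sum_rep_Nil)
  next
    case (Cons \<rho> L)
    then have \<rho>: "irreducible_rep G \<rho>" and L': "\<And>\<tau>. \<tau> \<in> set L \<Longrightarrow> irreducible_rep G \<tau>"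
      by simp_all
    \<comment> \<open>Now the whole sum over \<open>M\<close> plays the role of one summand of the
      target, again padded by an empty block.\<close>
    let ?F = "isotypic_proj G \<phi> M" and ?F' = "isotypic_proj G \<phi> []"
    have "intertwiners_commute G (direct_sum_rep (\<rho> # L)) (isotypic_proj G \<phi> (\<rho> # L)) (direct_sum_rep [direct_sum_rep M])
       (four_block_mat ?F (0\<^sub>m (dim_row ?F) (dim_col ?F')) (0\<^sub>m (dim_row ?F') (dim_col ?F)) ?F')"
      unfolding isotypic_proj_Cons[of G \<phi> \<rho> L]
    proof (rule intertwiners_commute_direct_sum_Cons)
      show "intertwiners_commute G \<rho> (isotypic_proj G \<phi> [\<rho>]) (direct_sum_rep []) ?F'"
        by (rule intertwiners_commute_empty[OF _ carrier1 carrier]) (simp add: direct_sum_rep_Nil)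
      show "intertwiners_commute G (direct_sum_rep L) (isotypic_proj G \<phi> L) (direct_sum_rep []) ?F'"
        by (rule intertwiners_commute_empty[OF _ carrier carrier]) (simp add: direct_sum_rep_Nil)
      show "intertwiners_commute G \<rho> (isotypic_proj G \<phi> [\<rho>]) (direct_sum_rep M) ?F"
        using \<rho> M by (rule single)
      show "intertwiners_commute G (direct_sum_rep L) (isotypic_proj G \<phi> L) (direct_sum_rep M) ?F"
        using L' by (rule Cons.IH)
      show "mat_rep G (direct_sum_rep L)" "mat_rep G (direct_sum_rep M)"
        using L' M by (auto intro: rep)
    qed (fact carrier carrier1 rep0 irreducible_rep_imp_mat_rep[OF \<rho>])+
    moreover have "four_block_mat ?F (0\<^sub>m (dim_row ?F) (dim_col ?F')) (0\<^sub>m (dim_row ?F') (dim_col ?F)) ?F' = ?F"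
      using diag_block_mat_singleton[of ?F] by (simp add: isotypic_proj_def)
    ultimately show ?case unfolding direct_sum_rep_singleton by simp
  qed
qed

text \<open>Every summand of type \<open>\<phi>\<close> contributes its own dimension, which is that
  of \<open>\<phi>\<close> because isomorphic representations have equal dimension.\<close>

lemma mat_trace_isotypic_proj:
  "mat_trace (isotypic_proj G \<phi> L) = of_nat (rep_dim \<phi> * length (filter (\<lambda>\<tau>. rep_iso G \<tau> \<phi>) L))"
proof (induction L)
  case Nil
  show ?case by (simp add: isotypic_proj_def mat_trace_def)
next
  case (Cons \<tau> L)
  have "mat_trace (isotypic_proj G \<phi> (\<tau> # L)) = mat_trace (isotypic_proj G \<phi> [\<tau>]) + mat_trace (isotypic_proj G \<phi> L)"
    unfolding isotypic_proj_Cons[of G \<phi> \<tau> L]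
    using isotypic_proj_carrier by (intro mat_trace_four_block)
  also have "mat_trace (isotypic_proj G \<phi> [\<tau>]) = (if rep_iso G \<tau> \<phi> then of_nat (rep_dim \<phi>) else 0)"
    using rep_iso_dim_eq[of G \<tau> \<phi>] by (simp add: isotypic_proj_singleton mat_trace_one mat_trace_zero)
  finally show ?case using Cons.IH by (simp add: algebra_simps)
qed

text \<open>Summands are counted up to isomorphism with \<open>\<phi>\<close>, so the two lists may
  contain different models of the same irreducible.\<close>

lemma multiplicity_unique:
  assumes L: "\<And>\<tau>. \<tau> \<in> set L \<Longrightarrow> irreducible_rep G \<tau>"
    and M: "\<And>\<tau>. \<tau> \<in> set M \<Longrightarrow> irreducible_rep G \<tau>"
    and \<phi>: "irreducible_rep G \<phi>"
    and iso: "rep_iso G (direct_sum_rep L) (direct_sum_rep M)"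
  shows "length (filter (\<lambda>\<tau>. rep_iso G \<tau> \<phi>) L) = length (filter (\<lambda>\<tau>. rep_iso G \<tau> \<phi>) M)"
proof -
  let ?n = "rep_dim (direct_sum_rep L)" and ?E = "isotypic_proj G \<phi> L" and ?F = "isotypic_proj G \<phi> M"
  have dim: "rep_dim (direct_sum_rep M) = ?n"
    using rep_iso_dim_eq[OF iso] by simp
  obtain P where P: "intertwiner G (direct_sum_rep L) (direct_sum_rep M) P" "invertible_mat P"
    using iso by (auto simp: rep_iso_iff_intertwiner)
  then have Pc: "P \<in> carrier_mat ?n ?n"
    by (simp add: intertwiner_def dim)
  then obtain Q where Q: "Q \<in> carrier_mat ?n ?n" "P * Q = 1\<^sub>m ?n" "Q * P = 1\<^sub>m ?n"
    using P(2) by (metis invertible_matE)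
  have car: "?E \<in> carrier_mat ?n ?n" "?F \<in> carrier_mat ?n ?n"
    using isotypic_proj_carrier[of G \<phi> L] isotypic_proj_carrier[of G \<phi> M] by (simp_all add: dim)
  have comm: "P * ?E = ?F * P"
    using intertwiners_commute_isotypic_proj[OF L M \<phi>] P(1) by (simp add: intertwiners_commute_def)
  \<comment> \<open>Since \<open>Q\<close> inverts \<open>P\<close>, \<open>comm\<close> exhibits
    \<open>?E\<close> as a conjugate of \<open>?F\<close>; cyclicity of the trace then equates their
    traces.\<close>
  have "?E = (Q * P) * ?E"
    using Q(3) car by simp
  also have "\<dots> = Q * (?F * P)"
    unfolding comm[symmetric] using Q(1) Pc car(1) by (rule assoc_mult_mat)
  finally have "mat_trace ?E = mat_trace (Q * (?F * P))" by simp
  also have "\<dots> = mat_trace ((?F * P) * Q)"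
    using Q(1) Pc car by (intro mat_trace_mult_commute[of _ ?n ?n]) auto
  also have "(?F * P) * Q = ?F"
    using car Q Pc assoc_mult_mat[OF car(2) Pc Q(1)] by simp
  finally have "(of_nat (rep_dim \<phi> * length (filter (\<lambda>\<tau>. rep_iso G \<tau> \<phi>) L)) :: complex)
     = of_nat (rep_dim \<phi> * length (filter (\<lambda>\<tau>. rep_iso G \<tau> \<phi>) M))"
    unfolding mat_trace_isotypic_proj .
  then have "rep_dim \<phi> * length (filter (\<lambda>\<tau>. rep_iso G \<tau> \<phi>) L)
     = rep_dim \<phi> * length (filter (\<lambda>\<tau>. rep_iso G \<tau> \<phi>) M)"
    by (rule iffD1[OF of_nat_eq_iff])
  \<comment> \<open>The common factor cancels because an irreducible representation has positive
    dimension.\<close>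
  then show ?thesis
    using \<phi> by (simp add: irreducible_rep_def)
qed

section \<open>Twisting by linear characters\<close>

text \<open>The tensor product with a one-dimensional representation, encoded as scaling so that the
  underlying space is unchanged.\<close>

definition twist_rep :: "('g \<Rightarrow> complex) \<Rightarrow> 'g rep \<Rightarrow> 'g rep" where
  "twist_rep \<chi> \<tau> = \<lparr>rep_dim = rep_dim \<tau>, rep_mat = (\<lambda>g. \<chi> g \<cdot>\<^sub>m rep_mat \<tau> g)\<rparr>"

text \<open>A homomorphism to the nonzero complex numbers, kept as a plain function so that
  quotients and inverses are formed pointwise.\<close>

definition linear_character :: "('g, 'b) monoid_scheme \<Rightarrow> ('g \<Rightarrow> complex) \<Rightarrow> bool" where
  "linear_character G \<chi> \<longleftrightarrow> (\<forall>g \<in> carrier G. \<chi> g \<noteq> 0) \<and>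
     (\<forall>g \<in> carrier G. \<forall>h \<in> carrier G. \<chi> (g \<otimes>\<^bsub>G\<^esub> h) = \<chi> g * \<chi> h)"

lemma linear_character_divide:
  "linear_character G \<chi> \<Longrightarrow> linear_character G \<psi> \<Longrightarrow> linear_character G (\<lambda>g. \<chi> g / \<psi> g)"
  by (simp add: linear_character_def)

lemma rep_dim_twist_rep [simp]: "rep_dim (twist_rep \<chi> \<tau>) = rep_dim \<tau>"
  and rep_mat_twist_rep [simp]: "rep_mat (twist_rep \<chi> \<tau>) g = \<chi> g \<cdot>\<^sub>m rep_mat \<tau> g"
  by (simp_all add: twist_rep_def)

lemma mat_rep_twist_rep: "mat_rep G \<tau> \<Longrightarrow> mat_rep G (twist_rep \<chi> \<tau>)"
  by (simp add: mat_rep_def)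

lemma smult_smult_mat: "a \<cdot>\<^sub>m (b \<cdot>\<^sub>m A) = (a * b :: 'a :: semigroup_mult) \<cdot>\<^sub>m A"
  by (rule eq_matI) (auto simp: mult.assoc)

lemma one_smult_mat: "(1 :: 'a :: monoid_mult) \<cdot>\<^sub>m A = A"
  by (rule eq_matI) auto

lemma group_rep_twist_rep:
  assumes \<chi>: "linear_character G \<chi>" and \<tau>: "group_rep G \<tau>"
  shows "group_rep G (twist_rep \<chi> \<tau>)"
  unfolding group_rep_iff rep_dim_twist_rep rep_mat_twist_rep
proof (intro conjI ballI)
  let ?n = "rep_dim \<tau>"
  note car = mat_repD[OF group_rep_imp_mat_rep[OF \<tau>]]
  fix g assume g: "g \<in> carrier G"
  then obtain B where B: "B \<in> carrier_mat ?n ?n" "B * rep_mat \<tau> g = 1\<^sub>m ?n" "rep_mat \<tau> g * B = 1\<^sub>m ?n"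
    using \<tau> unfolding group_rep_iff by blast
  have "\<chi> g \<noteq> 0" using \<chi> g by (simp add: linear_character_def)
  then have "(inverse (\<chi> g) \<cdot>\<^sub>m B) * (\<chi> g \<cdot>\<^sub>m rep_mat \<tau> g) = 1\<^sub>m ?n"
    "(\<chi> g \<cdot>\<^sub>m rep_mat \<tau> g) * (inverse (\<chi> g) \<cdot>\<^sub>m B) = 1\<^sub>m ?n"
    using B car[OF g]
    by (simp_all add: mult_smult_distrib[of _ ?n ?n _ ?n] mult_smult_assoc_mat[of _ ?n ?n _ ?n]
        smult_smult_mat one_smult_mat)
  then show "\<exists>B \<in> carrier_mat ?n ?n. \<chi> g \<cdot>\<^sub>m rep_mat \<tau> g \<in> carrier_mat ?n ?n \<and>
      B * (\<chi> g \<cdot>\<^sub>m rep_mat \<tau> g) = 1\<^sub>m ?n \<and> \<chi> g \<cdot>\<^sub>m rep_mat \<tau> g * B = 1\<^sub>m ?n"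
    using B car[OF g] by (intro bexI[of _ "inverse (\<chi> g) \<cdot>\<^sub>m B"]) auto
  fix h assume h: "h \<in> carrier G"
  have "rep_mat \<tau> (g \<otimes>\<^bsub>G\<^esub> h) = rep_mat \<tau> g * rep_mat \<tau> h" "\<chi> (g \<otimes>\<^bsub>G\<^esub> h) = \<chi> g * \<chi> h"
    using \<tau> \<chi> g h unfolding group_rep_iff linear_character_def by blast+
  then show "\<chi> (g \<otimes>\<^bsub>G\<^esub> h) \<cdot>\<^sub>m rep_mat \<tau> (g \<otimes>\<^bsub>G\<^esub> h) = \<chi> g \<cdot>\<^sub>m rep_mat \<tau> g * (\<chi> h \<cdot>\<^sub>m rep_mat \<tau> h)"
    using car[OF g] car[OF h]
    by (simp add: mult_smult_distrib[of _ ?n ?n _ ?n] mult_smult_assoc_mat[of _ ?n ?n _ ?n]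
        smult_smult_mat mult.commute)
qed

lemma smult_mat_mult_vec:
  fixes A :: "'a :: comm_semiring_0 mat"
  assumes "A \<in> carrier_mat n m" "v \<in> carrier_vec m"
  shows "(c \<cdot>\<^sub>m A) *\<^sub>v v = c \<cdot>\<^sub>v (A *\<^sub>v v)"
  using assms by (intro eq_vecI) (auto simp: scalar_prod_def sum_distrib_left mult.assoc)

text \<open>Scaling a matrix by a nonzero number does not change which subspaces it
  preserves.\<close>

lemma irreducible_rep_twist_rep:
  assumes \<chi>: "linear_character G \<chi>" and \<tau>: "irreducible_rep G \<tau>"
  shows "irreducible_rep G (twist_rep \<chi> \<tau>)"
  unfolding irreducible_rep_def rep_dim_twist_rep rep_mat_twist_rep
proof (intro conjI allI impI)
  show "group_rep G (twist_rep \<chi> \<tau>)"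
    using \<chi> \<tau> by (auto intro: group_rep_twist_rep simp: irreducible_rep_def)
  show "rep_dim \<tau> > 0"
    using \<tau> by (simp add: irreducible_rep_def)
  fix W assume W: "VectorSpace.subspace class_ring W (module_vec TYPE(complex) (rep_dim \<tau>)) \<and>
      (\<forall>g \<in> carrier G. \<forall>w \<in> W. \<chi> g \<cdot>\<^sub>m rep_mat \<tau> g *\<^sub>v w \<in> W)"
  then have sub: "W \<subseteq> carrier_vec (rep_dim \<tau>)"
    by (auto simp: VectorSpace.subspace_def submodule_def module_vec_simps)
  have "rep_mat \<tau> g *\<^sub>v w \<in> W" if g: "g \<in> carrier G" and w: "w \<in> W" for g w
  proof -
    have "\<chi> g \<noteq> 0" using \<chi> g by (simp add: linear_character_def)
    moreover have "(\<chi> g \<cdot>\<^sub>m rep_mat \<tau> g) *\<^sub>v w = \<chi> g \<cdot>\<^sub>v (rep_mat \<tau> g *\<^sub>v w)"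
      using w sub mat_repD[OF irreducible_rep_imp_mat_rep[OF \<tau>] g] by (intro smult_mat_mult_vec) auto
    ultimately have "rep_mat \<tau> g *\<^sub>v w = inverse (\<chi> g) \<cdot>\<^sub>v ((\<chi> g \<cdot>\<^sub>m rep_mat \<tau> g) *\<^sub>v w)"
      by (simp add: smult_smult_assoc)
    then show ?thesis using W g w vec_subspace_smult_closed by metis
  qed
  then show "W = {0\<^sub>v (rep_dim \<tau>)} \<or> W = carrier_vec (rep_dim \<tau>)"
    using W \<tau> unfolding irreducible_rep_def by blast
qed

text \<open>The same matrix \<open>P\<close> intertwines the twists, since scalars pass through
  matrix products.\<close>

lemma rep_iso_twist_rep:
  assumes iso: "rep_iso G \<rho> \<tau>" and reps: "mat_rep G \<rho>" "mat_rep G \<tau>"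
  shows "rep_iso G (twist_rep \<chi> \<rho>) (twist_rep \<chi> \<tau>)"
proof -
  let ?n = "rep_dim \<rho>" and ?m = "rep_dim \<tau>"
  obtain P where P: "P \<in> carrier_mat ?m ?n" "invertible_mat P"
    and comm: "\<And>g. g \<in> carrier G \<Longrightarrow> P * rep_mat \<rho> g = rep_mat \<tau> g * P"
    using iso unfolding rep_iso_def by blast
  have "P * (\<chi> g \<cdot>\<^sub>m rep_mat \<rho> g) = (\<chi> g \<cdot>\<^sub>m rep_mat \<tau> g) * P" if g: "g \<in> carrier G" for g
    using mult_smult_distrib[OF P(1) mat_repD[OF reps(1) g]]
      mult_smult_assoc_mat[OF mat_repD[OF reps(2) g] P(1)] comm[OF g] by simp
  then show ?thesis
    unfolding rep_iso_def rep_dim_twist_rep rep_mat_twist_rep using P by blast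
qed

text \<open>Stated up to isomorphism because \<open>\<chi>\<close> may vanish outside the
  carrier.\<close>

lemma twist_rep_inverse:
  assumes \<chi>: "linear_character G \<chi>" and \<tau>: "mat_rep G \<tau>"
  shows "rep_iso G (twist_rep (\<lambda>g. inverse (\<chi> g)) (twist_rep \<chi> \<tau>)) \<tau>"
proof (rule rep_iso_cong)
  fix g assume "g \<in> carrier G"
  then have "\<chi> g \<noteq> 0" using \<chi> by (simp add: linear_character_def)
  then show "rep_mat (twist_rep (\<lambda>g. inverse (\<chi> g)) (twist_rep \<chi> \<tau>)) g = rep_mat \<tau> g"
    by (auto intro!: eq_matI)
qed (auto intro: mat_rep_twist_rep \<tau>)

text \<open>Together with \<open>direct_sum_rep_twist_rep\<close> this turns a twisted decomposition
  of \<open>tensor_rep \<rho> \<tau>\<close> into a decomposition of the tensor product with the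
  twist of \<open>\<tau>\<close>.\<close>

lemma tensor_rep_twist_rep: "tensor_rep \<rho> (twist_rep \<chi> \<tau>) = twist_rep \<chi> (tensor_rep \<rho> \<tau>)"
  by (simp add: tensor_rep_def twist_rep_def kronecker_smult_right)

lemma direct_sum_rep_twist_rep:
  "direct_sum_rep (map (twist_rep \<chi>) L) = twist_rep \<chi> (direct_sum_rep L)"
proof -
  have "diag_block_mat (map (\<lambda>\<tau>. \<chi> g \<cdot>\<^sub>m rep_mat \<tau> g) L) = \<chi> g \<cdot>\<^sub>m diag_block_mat (map (\<lambda>\<tau>. rep_mat \<tau> g) L)" for g
    using diag_block_mat_smult[of "\<chi> g" "map (\<lambda>\<tau>. rep_mat \<tau> g) L"] by (simp add: o_def)
  then show ?thesis
    by (simp add: direct_sum_rep_def twist_rep_def o_def)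
qed

lemma mat_rep_tensor_rep: "mat_rep G \<rho> \<Longrightarrow> mat_rep G \<tau> \<Longrightarrow> mat_rep G (tensor_rep \<rho> \<tau>)"
  by (auto simp: mat_rep_def tensor_rep_def)

text \<open>The Kronecker product of the identity with \<open>P\<close> intertwines; the
  mixed-product rule gives this and also its inverse.\<close>

lemma rep_iso_tensor_rep:
  assumes iso: "rep_iso G \<sigma> \<tau>" and reps: "mat_rep G \<rho>" "mat_rep G \<sigma>" "mat_rep G \<tau>"
  shows "rep_iso G (tensor_rep \<rho> \<sigma>) (tensor_rep \<rho> \<tau>)"
proof -
  let ?d = "rep_dim \<rho>" and ?n = "rep_dim \<sigma>"
  have dim: "rep_dim \<tau> = ?n" using rep_iso_dim_eq[OF iso] by simp
  obtain P where P: "P \<in> carrier_mat ?n ?n" and "invertible_mat P"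
    and comm: "\<And>g. g \<in> carrier G \<Longrightarrow> P * rep_mat \<sigma> g = rep_mat \<tau> g * P"
    using iso unfolding rep_iso_def dim by blast
  then obtain Q where Q: "Q \<in> carrier_mat ?n ?n" "P * Q = 1\<^sub>m ?n" "Q * P = 1\<^sub>m ?n"
    by (metis invertible_matE)
  let ?I = "1\<^sub>m ?d :: complex mat"
  have one: "?I \<in> carrier_mat ?d ?d" by simp
  have "kronecker ?I P * kronecker (rep_mat \<rho> g) (rep_mat \<sigma> g)
      = kronecker (rep_mat \<rho> g) (rep_mat \<tau> g) * kronecker ?I P" if g: "g \<in> carrier G" for g
  proof -
    have c: "rep_mat \<rho> g \<in> carrier_mat ?d ?d" "rep_mat \<sigma> g \<in> carrier_mat ?n ?n" "rep_mat \<tau> g \<in> carrier_mat ?n ?n"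
      using mat_repD[OF reps(1) g] mat_repD[OF reps(2) g] mat_repD[OF reps(3) g] by (simp_all add: dim)
    show ?thesis
      using kronecker_mult[OF one P c(1,2)] kronecker_mult[OF c(1,3) one P] c(1) comm[OF g] by simp
  qed
  moreover have "invertible_mat (kronecker ?I P)"
    using kronecker_mult[OF one P one Q(1)] kronecker_mult[OF one Q(1) one P] P Q
    by (intro invertible_matI[of _ "?d * ?n" "kronecker ?I Q"]) (auto simp: kronecker_one)
  ultimately show ?thesis
    unfolding rep_iso_def tensor_rep_def using P by (intro bexI[of _ "kronecker ?I P"]) (auto simp: dim)
qed

text \<open>Matrices of size 1 multiply like their single entries, and invertibility makes the entry
  nonzero.\<close>

lemma linear_character_one_dim:
  assumes \<tau>: "group_rep G \<tau>" and dim: "rep_dim \<tau> = 1"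
  shows "linear_character G (\<lambda>g. rep_mat \<tau> g $$ (0, 0))"
  unfolding linear_character_def
proof (intro conjI ballI)
  note car = mat_repD[OF group_rep_imp_mat_rep[OF \<tau>], unfolded dim]
  have mult: "(A * B) $$ (0, 0) = A $$ (0, 0) * B $$ (0, 0)"
    if "A \<in> carrier_mat 1 1" "B \<in> carrier_mat 1 1" for A B :: "complex mat"
    using that by (auto simp: scalar_prod_def)
  fix g assume g: "g \<in> carrier G"
  then obtain B where B: "B \<in> carrier_mat 1 1" "B * rep_mat \<tau> g = 1\<^sub>m 1"
    using \<tau> unfolding group_rep_iff dim by blast
  show "rep_mat \<tau> g $$ (0, 0) \<noteq> 0"
    using mult[OF B(1) car[OF g]] unfolding B(2) by auto
  fix h assume h: "h \<in> carrier G"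
  have "rep_mat \<tau> (g \<otimes>\<^bsub>G\<^esub> h) = rep_mat \<tau> g * rep_mat \<tau> h"
    using \<tau> g h unfolding group_rep_iff by blast
  then show "rep_mat \<tau> (g \<otimes>\<^bsub>G\<^esub> h) $$ (0, 0) = rep_mat \<tau> g $$ (0, 0) * rep_mat \<tau> h $$ (0, 0)"
    using mult[OF car[OF g] car[OF h]] by simp
qed

text \<open>Supplies the twist that moves one one-dimensional vertex to another: the entry of
  \<open>\<sigma>\<close> cancels.\<close>

lemma one_dim_twist_rep:
  assumes \<sigma>: "group_rep G \<sigma>" "rep_dim \<sigma> = 1" and \<tau>: "group_rep G \<tau>" "rep_dim \<tau> = 1"
  shows "rep_iso G (twist_rep (\<lambda>g. rep_mat \<tau> g $$ (0, 0) / rep_mat \<sigma> g $$ (0, 0)) \<sigma>) \<tau>"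
proof (rule rep_iso_cong)
  fix g assume g: "g \<in> carrier G"
  have "rep_mat \<sigma> g $$ (0, 0) \<noteq> 0"
    using linear_character_one_dim[OF \<sigma>] g by (simp add: linear_character_def)
  then show "rep_mat (twist_rep (\<lambda>g. rep_mat \<tau> g $$ (0, 0) / rep_mat \<sigma> g $$ (0, 0)) \<sigma>) g = rep_mat \<tau> g"
    using mat_repD[OF group_rep_imp_mat_rep[OF \<sigma>(1)] g] mat_repD[OF group_rep_imp_mat_rep[OF \<tau>(1)] g] \<sigma>(2) \<tau>(2)
    by (intro eq_matI) auto
qed (use assms in \<open>auto intro: mat_rep_twist_rep group_rep_imp_mat_rep\<close>)

section \<open>Irreducible representations of abelian groups\<close>

lemma irreducible_rep_abelian_scalar:
  assumes G: "comm_group G" and \<tau>: "irreducible_rep G \<tau>" and h: "h \<in> carrier G"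
  shows "\<exists>c. rep_mat \<tau> h = c \<cdot>\<^sub>m 1\<^sub>m (rep_dim \<tau>)"
proof -
  interpret comm_group G by (rule G)
  let ?n = "rep_dim \<tau>"
  note rep = irreducible_rep_imp_mat_rep[OF \<tau>]
  note car = mat_repD[OF rep]
  have mult: "rep_mat \<tau> (g \<otimes>\<^bsub>G\<^esub> k) = rep_mat \<tau> g * rep_mat \<tau> k" if "g \<in> carrier G" "k \<in> carrier G" for g k
    using \<tau> that unfolding irreducible_rep_def group_rep_iff by blast
  have "?n > 0" using \<tau> by (simp add: irreducible_rep_def)
  then obtain c where "eigenvalue (rep_mat \<tau> h) c"
    using spectrum_non_empty[OF car[OF h]] by (auto simp: spectrum_def)
  then obtain v where v: "v \<in> carrier_vec ?n" "v \<noteq> 0\<^sub>v ?n" "rep_mat \<tau> h *\<^sub>v v = c \<cdot>\<^sub>v v"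
    using car[OF h] by (auto simp: eigenvalue_def eigenvector_def)
  \<comment> \<open>\<open>P\<close> commutes with the action because \<open>G\<close> is abelian,
    and it kills the eigenvector \<open>v\<close>. An intertwiner from an irreducible with nonzero
    kernel vanishes, so \<open>h\<close> acts as the scalar \<open>c\<close>.\<close>
  define P where "P = rep_mat \<tau> h - c \<cdot>\<^sub>m 1\<^sub>m ?n"
  have Pc: "P \<in> carrier_mat ?n ?n" unfolding P_def by (rule minus_carrier_mat) simp
  have I: "c \<cdot>\<^sub>m 1\<^sub>m ?n \<in> carrier_mat ?n ?n" by simp
  have "intertwiner G \<tau> \<tau> P"
    unfolding intertwiner_def
  proof (intro conjI ballI)
    fix g assume g: "g \<in> carrier G"
    have "rep_mat \<tau> h * rep_mat \<tau> g = rep_mat \<tau> g * rep_mat \<tau> h"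
      using g h mult m_comm by metis
    then show "P * rep_mat \<tau> g = rep_mat \<tau> g * P"
      unfolding P_def minus_mult_distrib_mat[OF car[OF h] I car[OF g]]
        mult_minus_distrib_mat[OF car[OF g] car[OF h] I]
      using car[OF g] mult_smult_assoc_mat[OF one_carrier_mat car[OF g]]
        mult_smult_distrib[OF car[OF g] one_carrier_mat] by simp
  qed (rule Pc)
  then have "mat_kernel P = {0\<^sub>v ?n} \<or> P = 0\<^sub>m ?n ?n"
    by (rule intertwiner_kernel[OF \<tau> rep])
  moreover have "v \<in> mat_kernel P"
  proof (rule mat_kernelI[OF Pc v(1)])
    show "P *\<^sub>v v = 0\<^sub>v ?n"
      unfolding P_def minus_mult_distrib_mat_vec[OF car[OF h] I v(1)]
      using v by (simp add: smult_mat_mult_vec[OF one_carrier_mat v(1)])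
  qed
  ultimately have P0: "P = 0\<^sub>m ?n ?n" using v(2) by auto
  have "rep_mat \<tau> h = c \<cdot>\<^sub>m 1\<^sub>m ?n"
  proof (rule eq_matI)
    fix i j assume ij: "i < dim_row (c \<cdot>\<^sub>m 1\<^sub>m ?n)" "j < dim_col (c \<cdot>\<^sub>m 1\<^sub>m ?n)"
    have "P $$ (i, j) = 0" using P0 ij by simp
    then show "rep_mat \<tau> h $$ (i, j) = (c \<cdot>\<^sub>m 1\<^sub>m ?n) $$ (i, j)"
      using ij car[OF h] by (auto simp: P_def)
  qed (use car[OF h] in auto)
  then show ?thesis ..
qed

text \<open>All group elements act as scalars, so the line through the first unit vector is
  invariant; in dimension above 1 it is a proper nonzero subspace.\<close>

lemma irreducible_rep_abelian_dim:
  assumes G: "comm_group G" and \<tau>: "irreducible_rep G \<tau>"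
  shows "rep_dim \<tau> = 1"
proof (rule ccontr)
  let ?n = "rep_dim \<tau>"
  let ?W = "range (\<lambda>c :: complex. c \<cdot>\<^sub>v unit_vec ?n 0)"
  assume "?n \<noteq> 1"
  moreover have "?n > 0" using \<tau> by (simp add: irreducible_rep_def)
  ultimately have n: "?n > 1" by simp
  have "?W = {0\<^sub>v ?n} \<or> ?W = carrier_vec ?n"
  proof (rule irreducible_repD[OF \<tau>])
    show "0\<^sub>v ?n \<in> ?W" by (rule image_eqI[of _ _ 0]) auto
    fix v w assume "v \<in> ?W" "w \<in> ?W"
    then obtain a b where "v = a \<cdot>\<^sub>v unit_vec ?n 0" "w = b \<cdot>\<^sub>v unit_vec ?n 0" by auto
    then show "v + w \<in> ?W"
      by (intro image_eqI[of _ _ "a + b"]) (auto simp: add_smult_distrib_vec)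
  next
    fix c v assume "v \<in> ?W"
    then show "c \<cdot>\<^sub>v v \<in> ?W" by (auto simp: smult_smult_assoc)
  next
    fix g w assume g: "g \<in> carrier G" and "w \<in> ?W"
    then obtain a where w: "w = a \<cdot>\<^sub>v unit_vec ?n 0" by auto
    obtain c where "rep_mat \<tau> g = c \<cdot>\<^sub>m 1\<^sub>m ?n"
      using irreducible_rep_abelian_scalar[OF G \<tau> g] by auto
    then have "rep_mat \<tau> g *\<^sub>v w = (c * a) \<cdot>\<^sub>v unit_vec ?n 0"
      using smult_mat_mult_vec[OF one_carrier_mat, of w ?n c] w by (simp add: smult_smult_assoc)
    then show "rep_mat \<tau> g *\<^sub>v w \<in> ?W" by auto
  qed auto
  moreover have "unit_vec ?n 0 \<in> ?W"
    by (rule image_eqI[of _ _ 1]) (auto intro!: eq_vecI)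
  moreover have "unit_vec ?n 0 \<noteq> (0\<^sub>v ?n :: complex vec)"
    using n by (intro unit_vec_nonzero) auto
  ultimately have "?W = carrier_vec ?n" by blast
  \<comment> \<open>If the line were the whole space, it would contain the second unit vector, whose
    entry at index 1 is nonzero while all of the line vanishes there.\<close>
  then obtain c :: complex where "unit_vec ?n 1 = c \<cdot>\<^sub>v unit_vec ?n 0"
    by (metis (no_types, lifting) image_iff unit_vec_carrier)
  then have "(unit_vec ?n 1 :: complex vec) $ 1 = (c \<cdot>\<^sub>v unit_vec ?n 0) $ 1" by simp
  then show False using n by simp
qed

section \<open>The permutation of the irreducibles induced by a twist\<close>

lemma length_filter_replicate_family:
  "length (filter P (concat (map (\<lambda>j. replicate (m j) (f j)) js))) = (\<Sum>j\<leftarrow>js. if P (f j) then m j else 0)"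
  by (induction js) auto

text \<open>Recovers a McKay matrix entry from a list of summands: the predicate singles out one
  member of the family, and only its copies survive the filter.\<close>

lemma multiplicity_in_family:
  assumes "k \<in> {1..r}" "\<And>j. j \<in> {1..r} \<Longrightarrow> P (f j) \<longleftrightarrow> j = k"
  shows "length (filter P (concat (map (\<lambda>j. replicate (m j) (f j)) [1..<Suc r]))) = m k"
proof -
  have "length (filter P (concat (map (\<lambda>j. replicate (m j) (f j)) [1..<Suc r])))
      = (\<Sum>j\<in>{1..r}. if P (f j) then m j else 0)"
    unfolding length_filter_replicate_family
    by (simp add: interv_sum_list_conv_sum_set_nat atLeastLessThanSuc_atLeastAtMost del: upt_Suc)
  also have "\<dots> = (\<Sum>j\<in>{1..r}. if j = k then m j else 0)"
    using assms(2) by (intro sum.cong) auto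
  finally show ?thesis using assms(1) by simp
qed

text \<open>Completeness of the list defines \<open>\<pi>\<close>. Twisting a decomposition for
  vertex \<open>i\<close> yields one for vertex \<open>\<pi> i\<close>, and uniqueness of
  multiplicities compares the two rows of \<open>a\<close>.\<close>

lemma twist_permutation:
  assumes \<rho>: "mat_rep G \<rho>" and irr: "complete_irreps G r \<sigma>" and a: "mckay_matrix G \<rho> r \<sigma> a"
    and \<chi>: "linear_character G \<chi>"
  obtains \<pi> where "bij_betw \<pi> {1..r} {1..r}"
    and "\<And>j. j \<in> {1..r} \<Longrightarrow> rep_iso G (twist_rep \<chi> (\<sigma> j)) (\<sigma> (\<pi> j))"
    and "\<And>i j. i \<in> {1..r} \<Longrightarrow> j \<in> {1..r} \<Longrightarrow> a (\<pi> i) (\<pi> j) = a i j"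
proof -
  have \<sigma>: "irreducible_rep G (\<sigma> j)" if "j \<in> {1..r}" for j
    using irr that unfolding complete_irreps_def by blast
  have uniq: "i = j" if "i \<in> {1..r}" "j \<in> {1..r}" "rep_iso G (\<sigma> i) (\<sigma> j)" for i j
    using irr that unfolding complete_irreps_def by blast
  have \<sigma>\<chi>: "irreducible_rep G (twist_rep \<chi> (\<sigma> j))" if "j \<in> {1..r}" for j
    using irreducible_rep_twist_rep[OF \<chi> \<sigma>[OF that]] .
  have "\<forall>j \<in> {1..r}. \<exists>k \<in> {1..r}. rep_iso G (twist_rep \<chi> (\<sigma> j)) (\<sigma> k)"
    using irr \<sigma>\<chi> unfolding complete_irreps_def by blast
  then obtain \<pi> where \<pi>: "\<And>j. j \<in> {1..r} \<Longrightarrow> \<pi> j \<in> {1..r}"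
    and iso: "\<And>j. j \<in> {1..r} \<Longrightarrow> rep_iso G (twist_rep \<chi> (\<sigma> j)) (\<sigma> (\<pi> j))"
    by metis
  note rep = irreducible_rep_imp_mat_rep[OF \<sigma>] and rep\<chi> = irreducible_rep_imp_mat_rep[OF \<sigma>\<chi>]
  \<comment> \<open>Twisting by the inverse character undoes the twist, so isomorphic twists come
    from isomorphic irreducibles, which are pairwise distinct in the list.\<close>
  have inj: "inj_on \<pi> {1..r}"
  proof (rule inj_onI)
    fix i j assume ij: "i \<in> {1..r}" "j \<in> {1..r}" "\<pi> i = \<pi> j"
    let ?\<psi> = "\<lambda>g. inverse (\<chi> g)"
    have iso\<chi>: "rep_iso G (twist_rep \<chi> (\<sigma> i)) (twist_rep \<chi> (\<sigma> j))"
      using rep_iso_trans[OF iso[OF ij(1)] rep_iso_sym[OF iso[OF ij(2)], folded ij(3)]]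
        rep rep\<chi> \<pi> ij by metis
    have "rep_iso G (twist_rep ?\<psi> (twist_rep \<chi> (\<sigma> i))) (twist_rep ?\<psi> (twist_rep \<chi> (\<sigma> j)))"
      by (rule rep_iso_twist_rep[OF iso\<chi> rep\<chi>[OF ij(1)] rep\<chi>[OF ij(2)]])
    moreover have "rep_iso G (\<sigma> i) (twist_rep ?\<psi> (twist_rep \<chi> (\<sigma> i)))"
      "rep_iso G (twist_rep ?\<psi> (twist_rep \<chi> (\<sigma> j))) (\<sigma> j)"
      using rep ij \<chi> by (auto intro!: rep_iso_sym[OF twist_rep_inverse] twist_rep_inverse mat_rep_twist_rep
        simp del: atLeastAtMost_iff)
    ultimately have "rep_iso G (\<sigma> i) (\<sigma> j)"
      using rep_iso_trans mat_rep_twist_rep rep ij by metis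
    then show "i = j" using uniq ij by blast
  qed
  have bij: "bij_betw \<pi> {1..r} {1..r}"
  proof (rule bij_betw_imageI[OF inj])
    have "\<pi> ` {1..r} \<subseteq> {1..r}" using \<pi> by blast
    then show "\<pi> ` {1..r} = {1..r}" using inj by (intro endo_inj_surj) auto
  qed
  have "a (\<pi> i) (\<pi> j) = a i j" if i: "i \<in> {1..r}" and j: "j \<in> {1..r}" for i j
  proof -
    \<comment> \<open>\<open>S k\<close> lists the irreducible summands that row \<open>k\<close> of
      \<open>a\<close> prescribes for the tensor product of \<open>\<rho>\<close> with
      \<open>\<sigma> k\<close>.\<close>
    define S where "S k = concat (map (\<lambda>j. replicate (a k j) (\<sigma> j)) [1..<Suc r])" for k
    have S: "irreducible_rep G \<tau>" if "\<tau> \<in> set (S k)" for \<tau> k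
      using that \<sigma> by (auto simp: S_def)
    have S\<chi>: "irreducible_rep G \<tau>" if "\<tau> \<in> set (map (twist_rep \<chi>) (S k))" for \<tau> k
      using that S irreducible_rep_twist_rep[OF \<chi>] by auto
    have repS: "mat_rep G (direct_sum_rep (S k))" for k
      using S by (intro mat_rep_direct_sum irreducible_rep_imp_mat_rep)
    have ten: "rep_iso G (tensor_rep \<rho> (\<sigma> k)) (direct_sum_rep (S k))" if "k \<in> {1..r}" for k
      using a that unfolding mckay_matrix_def S_def by blast
    have repS\<chi>: "mat_rep G (direct_sum_rep (map (twist_rep \<chi>) (S i)))"
      unfolding direct_sum_rep_twist_rep by (rule mat_rep_twist_rep[OF repS])
    note repT = mat_rep_tensor_rep[OF \<rho> rep[OF i]] mat_rep_tensor_rep[OF \<rho> rep[OF \<pi>[OF i]]]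
    have "rep_iso G (direct_sum_rep (S i)) (tensor_rep \<rho> (\<sigma> i))"
      by (rule rep_iso_sym[OF ten[OF i] repT(1) repS])
    then have iso1: "rep_iso G (direct_sum_rep (map (twist_rep \<chi>) (S i))) (twist_rep \<chi> (tensor_rep \<rho> (\<sigma> i)))"
      unfolding direct_sum_rep_twist_rep using repS repT(1) by (rule rep_iso_twist_rep)
    have iso2: "rep_iso G (twist_rep \<chi> (tensor_rep \<rho> (\<sigma> i))) (tensor_rep \<rho> (\<sigma> (\<pi> i)))"
      unfolding tensor_rep_twist_rep[symmetric] using iso[OF i] \<rho> rep\<chi>[OF i] rep[OF \<pi>[OF i]]
      by (rule rep_iso_tensor_rep)
    have "rep_iso G (direct_sum_rep (map (twist_rep \<chi>) (S i))) (tensor_rep \<rho> (\<sigma> (\<pi> i)))"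
      using iso1 iso2 repS\<chi> mat_rep_twist_rep[OF repT(1)] repT(2) by (rule rep_iso_trans)
    then have "rep_iso G (direct_sum_rep (map (twist_rep \<chi>) (S i))) (direct_sum_rep (S (\<pi> i)))"
      using ten[OF \<pi>[OF i]] repS\<chi> repT(2) repS by (rule rep_iso_trans)
    \<comment> \<open>Count copies of \<open>\<sigma> (\<pi> j)\<close> on both sides. On the left
      only the twist of \<open>\<sigma> j\<close> has this type, by injectivity of
      \<open>\<pi>\<close>, giving \<open>a i j\<close>; on the right the count is
      \<open>a (\<pi> i) (\<pi> j)\<close>.\<close>
    from multiplicity_unique[OF S\<chi> S \<sigma>[OF \<pi>[OF j]] this]
    have "length (filter (\<lambda>\<tau>. rep_iso G \<tau> (\<sigma> (\<pi> j))) (map (twist_rep \<chi>) (S i)))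
        = length (filter (\<lambda>\<tau>. rep_iso G \<tau> (\<sigma> (\<pi> j))) (S (\<pi> i)))" .
    moreover have "map (twist_rep \<chi>) (S i) = concat (map (\<lambda>j. replicate (a i j) (twist_rep \<chi> (\<sigma> j))) [1..<Suc r])"
      by (simp add: S_def map_concat o_def del: upt_Suc)
    moreover have "length (filter (\<lambda>\<tau>. rep_iso G \<tau> (\<sigma> (\<pi> j)))
        (concat (map (\<lambda>j. replicate (a i j) (twist_rep \<chi> (\<sigma> j))) [1..<Suc r]))) = a i j"
    proof (rule multiplicity_in_family[OF j])
      fix k assume k: "k \<in> {1..r}"
      have "\<pi> k = \<pi> j" if "rep_iso G (twist_rep \<chi> (\<sigma> k)) (\<sigma> (\<pi> j))"
        using that iso[OF k] uniq[OF \<pi>[OF k] \<pi>[OF j]] rep_iso_sym rep_iso_trans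
          rep\<chi>[OF k] rep[OF \<pi>[OF k]] rep[OF \<pi>[OF j]] by metis
      then show "rep_iso G (twist_rep \<chi> (\<sigma> k)) (\<sigma> (\<pi> j)) \<longleftrightarrow> k = j"
        using iso[OF j] inj_onD[OF inj _ k j] by blast
    qed
    moreover have "length (filter (\<lambda>\<tau>. rep_iso G \<tau> (\<sigma> (\<pi> j))) (S (\<pi> i))) = a (\<pi> i) (\<pi> j)"
      unfolding S_def
      by (rule multiplicity_in_family[OF \<pi>[OF j]]) (use uniq \<pi>[OF j] rep rep_iso_refl in metis)
    ultimately show ?thesis by simp
  qed
  with bij iso show thesis by (rule that)
qed

section \<open>Components of the McKay quiver through one-dimensional vertices\<close>

theorem proposition4p2:
  fixes G :: "('g, 'b) monoid_scheme"
    and \<rho> :: "'g rep"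
    and r :: nat
    and \<sigma> :: "nat \<Rightarrow> 'g rep"
    and a :: "nat \<Rightarrow> nat \<Rightarrow> nat"
    and components :: "(nat, nat \<times> nat \<times> nat) pre_digraph set"
  assumes "group G" and "finite (carrier G)"
    and "group_rep G \<rho>"
    and "complete_irreps G r \<sigma>"
    and "mckay_matrix G \<rho> r \<sigma> a"
    and "components = strong_components (mckay_quiver r a) \<or>
         components = weak_components (mckay_quiver r a)"
  shows "(\<forall>C \<in> components. \<forall>P \<in> components.
            1 \<in> verts P \<and> (\<exists>i \<in> verts C. rep_dim (\<sigma> i) = 1) \<longrightarrow> digraph_iso C P) \<and>
         (comm_group G \<longrightarrow> (\<forall>C \<in> components. \<forall>D \<in> components. digraph_iso C D))"
proof -
  have irr: "irreducible_rep G (\<sigma> i)" if "i \<in> {1..r}" for i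
    using assms(4) that unfolding complete_irreps_def by blast
  \<comment> \<open>Both notions of connectedness exclude the empty digraph, so every component
    supplies a vertex.\<close>
  have verts: "verts C \<noteq> {} \<and> verts C \<subseteq> {1..r}" if "C \<in> components" for C
    using assms(6) that
    by (auto simp: strong_components_def weak_components_def pre_digraph.sccs_altdef2
        pre_digraph.max_subgraph_def subgraph_def mckay_quiver_def strongly_connected_def connected_conv)
  \<comment> \<open>Two arbitrary one-dimensional vertices serve both claims: \<open>j = 1\<close>
    gives the principal component, and for abelian \<open>G\<close> any two vertices
    qualify.\<close>
  have main: "digraph_iso C D"
    if CD: "C \<in> components" "D \<in> components" and ij: "i \<in> verts C" "j \<in> verts D"
      and dim: "rep_dim (\<sigma> i) = 1" "rep_dim (\<sigma> j) = 1" for C D i j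
  proof -
    have i: "i \<in> {1..r}" and j: "j \<in> {1..r}"
      using verts CD ij by blast+
    then have gr: "group_rep G (\<sigma> i)" "group_rep G (\<sigma> j)"
      using irr by (auto simp: irreducible_rep_def)
    define \<chi> where "\<chi> g = rep_mat (\<sigma> j) g $$ (0, 0) / rep_mat (\<sigma> i) g $$ (0, 0)" for g
    have \<chi>: "linear_character G \<chi>"
      unfolding \<chi>_def using gr dim by (intro linear_character_divide linear_character_one_dim)
    obtain \<pi> where bij: "bij_betw \<pi> {1..r} {1..r}"
      and iso: "\<And>j. j \<in> {1..r} \<Longrightarrow> rep_iso G (twist_rep \<chi> (\<sigma> j)) (\<sigma> (\<pi> j))"
      and a: "\<And>i j. i \<in> {1..r} \<Longrightarrow> j \<in> {1..r} \<Longrightarrow> a (\<pi> i) (\<pi> j) = a i j"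
      by (rule twist_permutation[OF group_rep_imp_mat_rep[OF assms(3)] assms(4,5) \<chi>]) (rule that)
    have \<pi>i: "\<pi> i \<in> {1..r}" using bij i by (auto simp: bij_betw_def)
    have "rep_iso G (twist_rep \<chi> (\<sigma> i)) (\<sigma> j)"
      unfolding \<chi>_def using gr dim by (intro one_dim_twist_rep)
    \<comment> \<open>Both are isomorphic to the twist of \<open>\<sigma> i\<close>; the members of
      the list being pairwise non-isomorphic, the indices agree.\<close>
    then have "rep_iso G (\<sigma> (\<pi> i)) (\<sigma> j)"
      using iso[OF i] irr[OF i] irr[OF j] irr[OF \<pi>i] rep_iso_sym rep_iso_trans
        irreducible_rep_imp_mat_rep mat_rep_twist_rep by metis
    then have "\<pi> i = j"
      using assms(4) \<pi>i j unfolding complete_irreps_def by blast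
    then show ?thesis
      using mckay_quiver_components_iso[OF bij a assms(6) CD ij(1)] ij(2) by simp
  qed
  \<comment> \<open>\<open>\<sigma> 1\<close> is only isomorphic to \<open>trivial_rep\<close>, so
    its dimension is read off from the isomorphism.\<close>
  have "rep_dim (\<sigma> 1) = 1"
    using assms(4) rep_iso_dim_eq[of G "\<sigma> 1" trivial_rep] unfolding complete_irreps_def
    by (metis rep.select_convs(1) trivial_rep_def)
  then have "\<forall>C \<in> components. \<forall>P \<in> components.
      1 \<in> verts P \<and> (\<exists>i \<in> verts C. rep_dim (\<sigma> i) = 1) \<longrightarrow> digraph_iso C P"
    using main by blast
  moreover have "digraph_iso C D" if G: "comm_group G" and CD: "C \<in> components" "D \<in> components" for C D
  proof -
    obtain i j where ij: "i \<in> verts C" "j \<in> verts D" using verts CD by blast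
    then have "i \<in> {1..r}" "j \<in> {1..r}" using verts CD by blast+
    then show ?thesis
      using main[OF CD ij] irreducible_rep_abelian_dim[OF G] irr by blast
  qed
  ultimately show ?thesis by blast
qed

end
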